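(* Let $f:\mathbb{N}\times\mathbb{N}\to\mathbb{C}$ be a multiplicative function of two variables satisfying \[ \sum_{p\in\mathcal{P}}\ \sum_{\substack{e_1,e_2\ge 0\\ e_1+e_2\ge 1}}\frac{|(f*\mu)(p^{e_1},p^{e_2})|}{p^{e_1+e_2}}<\infty . \] Then for every $(n_1,n_2)\in\mathbb{N}\times\mathbb{N}$ the Ramanujan-Fourier series of $f$ converges and \[ f(n_1,n_2)=\sum_{q_1,q_2=1}^\infty a_{q_1,q_2}\,c_{q_1}(n_1)\,c_{q_2}(n_2), \qquad\text{where}\qquad a_{q_1,q_2}=\sum_{m_1,m_2=1}^\infty\frac{(f*\mu)(m_1q_1,m_2q_2)}{m_1q_1m_2q_2}. \] Moreover, if $M(f)\neq 0$ and $\mathrm{lcm}(q_1,q_2)>1$, then \[ a_{q_1,q_2}=\prod_{p\in\mathcal{P}}\Bigl(\sum_{e_1=\nu_p(q_1)}^\infty\sum_{e_2=\nu_p(q_2)}^\infty\frac{(f*\mu)(p^{e_1},p^{e_2})}{p^{e_1+e_2}}\Bigr) = M(f)\prod_{p\mid \mathrm{lcm}(q_1,q_2)}\frac{\displaystyle\sum_{e_1=\nu_p(q_1)}^\infty\sum_{e_2=\nu_p(q_2)}^\infty\frac{(f*\mu)(p^{e_1},p^{e_2})}{p^{e_1+e_2}}}{\displaystyle\sum_{e_1=0}^\infty\sum_{e_2=0}^\infty\frac{(f*\mu)(p^{e_1},p^{e_2})}{p^{e_1+e_2}}}. \]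
   Context: $\mathcal{P}$ is the set of primes. For positive integers $q,n$, the Ramanujan sum is $c_q(n)=\sum_{1\le a\le q,\ \gcd(a,q)=1}\exp(2\pi i a n/q)$. For arithmetic functions $f,g:\mathbb{N}\times\mathbb{N}\to\mathbb{C}$, the Dirichlet convolution is $(f*g)(n_1,n_2)=\sum_{m_1\mid n_1,\ m_2\mid n_2} f(m_1,m_2)\,g(n_1/m_1,n_2/m_2)$, and $\mu(n_1,n_2)=\mu(n_1)\mu(n_2)$ with $\mu$ the classical Möbius function. A function $f:\mathbb{N}\times\mathbb{N}\to\mathbb{C}$ is multiplicative (of two variables) if $f(m_1n_1,m_2n_2)=f(m_1,m_2)f(n_1,n_2)$ whenever $\gcd(m_1m_2,n_1n_2)=1$. For a prime $p$ and positive integer $q$, $\nu_p(q)$ is the exponent of $p$ in $q$ ($0$ if $p\nmid q$). $\mathrm{lcm}(q_1,q_2)$ is the least common multiple. The mean value of $f$ is $M(f)=\lim_{x,y\to\infty}\frac{1}{xy}\sum_{n_1\le x,\ n_2\le y}f(n_1,n_2)$; under the summability hypothesis above this limit is known to exist and to equal $\sum_{m_1,m_2\ge1}(f*\mu)(m_1,m_2)/(m_1m_2)=\prod_{p\in\mathcal{P}}\sum_{e_1,e_2\ge0}(f*\mu)(p^{e_1},p^{e_2})/p^{e_1+e_2}$. *)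

theory Defs
  imports "HOL-Analysis.Analysis" "HOL-Computational_Algebra.Squarefree"
begin

text \<open>
  Arithmetic functions of two variables live on the positive integers. They are represented as
  functions of type \<^typ>\<open>nat \<Rightarrow> nat \<Rightarrow> complex\<close> whose values at arguments with a zero component are
  irrelevant: everything below only inspects positive arguments.
\<close>

definition ramanujan_sum :: "nat \<Rightarrow> nat \<Rightarrow> complex" where
  "ramanujan_sum q n =
     (\<Sum>a\<in>{a. 1 \<le> a \<and> a \<le> q \<and> coprime a q}.
        exp (2 * of_real pi * \<i> * of_nat a * of_nat n / of_nat q))"

definition moebius :: "nat \<Rightarrow> int" where
  "moebius n = (if squarefree n then (-1) ^ card (prime_factors n) else 0)"

definition moebius2 :: "nat \<Rightarrow> nat \<Rightarrow> complex" where
  "moebius2 n1 n2 = of_int (moebius n1) * of_int (moebius n2)"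

definition dirichlet_conv2 ::
    "(nat \<Rightarrow> nat \<Rightarrow> complex) \<Rightarrow> (nat \<Rightarrow> nat \<Rightarrow> complex) \<Rightarrow> nat \<Rightarrow> nat \<Rightarrow> complex" where
  "dirichlet_conv2 f g n1 n2 =
     (\<Sum>m1 | m1 dvd n1. \<Sum>m2 | m2 dvd n2. f m1 m2 * g (n1 div m1) (n2 div m2))"

text \<open>The value at \<open>(1, 1)\<close> is not required to be 1, so the zero function is multiplicative.\<close>

definition multiplicative2 :: "(nat \<Rightarrow> nat \<Rightarrow> complex) \<Rightarrow> bool" where
  "multiplicative2 f \<longleftrightarrow>
     (\<forall>m1 m2 n1 n2. m1 > 0 \<longrightarrow> m2 > 0 \<longrightarrow> n1 > 0 \<longrightarrow> n2 > 0 \<longrightarrow> coprime (m1 * m2) (n1 * n2) \<longrightarrow>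
        f (m1 * n1) (m2 * n2) = f m1 m2 * f n1 n2)"

text \<open>The real variables \<open>x\<close> and \<open>y\<close> tend to infinity independently of each other.\<close>

definition mean_value :: "(nat \<Rightarrow> nat \<Rightarrow> complex) \<Rightarrow> complex" where
  "mean_value f =
     Lim (at_top \<times>\<^sub>F at_top)
       (\<lambda>(x::real, y::real).
          (\<Sum>n1 | 1 \<le> n1 \<and> real n1 \<le> x. \<Sum>n2 | 1 \<le> n2 \<and> real n2 \<le> y. f n1 n2) / of_real (x * y))"

definition rf_term ::
    "(nat \<Rightarrow> nat \<Rightarrow> complex) \<Rightarrow> nat \<Rightarrow> nat \<Rightarrow> nat \<times> nat \<Rightarrow> complex" where
  "rf_term f q1 q2 =
     (\<lambda>(m1, m2). dirichlet_conv2 f moebius2 (m1 * q1) (m2 * q2) / of_nat (m1 * q1 * m2 * q2))"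

definition rf_coeff :: "(nat \<Rightarrow> nat \<Rightarrow> complex) \<Rightarrow> nat \<Rightarrow> nat \<Rightarrow> complex" where
  "rf_coeff f q1 q2 = (\<Sum>\<^sub>\<infinity>m\<in>{1..} \<times> {1..}. rf_term f q1 q2 m)"

definition local_sum :: "(nat \<Rightarrow> nat \<Rightarrow> complex) \<Rightarrow> nat \<Rightarrow> nat \<Rightarrow> nat \<Rightarrow> complex" where
  "local_sum f p k1 k2 =
     (\<Sum>\<^sub>\<infinity>(e1, e2)\<in>{k1..} \<times> {k2..}.
        dirichlet_conv2 f moebius2 (p ^ e1) (p ^ e2) / of_nat (p ^ (e1 + e2)))"

end

theory Submission
  imports Defs
begin

text \<open>
  Write \<open>G(m\<^sub>1, m\<^sub>2) = (f * \<mu>)(m\<^sub>1, m\<^sub>2) / (m\<^sub>1 m\<^sub>2)\<close>, so that \<open>a\<close> at \<open>(q\<^sub>1, q\<^sub>2)\<close> is the sum of \<open>G\<close> over the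
  multiples of \<open>(q\<^sub>1, q\<^sub>2)\<close>. Since the sum of \<open>c\<^sub>q(n)\<close> over \<open>q\<close> dividing \<open>m\<close> is \<open>m\<close> if \<open>m\<close> divides
  \<open>n\<close> and \<open>0\<close> otherwise, interchanging the summations over \<open>q\<close> and \<open>m\<close> reduces the Ramanujan-Fourier
  series to Moebius inversion. The interchange is legitimate because the sum of \<open>\<bar>c\<^sub>q(n)\<bar>\<close> over \<open>q\<close>
  dividing \<open>m\<close> is at most \<open>\<sigma>(n) w(m)\<close>, where \<open>w(m)\<close> is the number of squarefree divisors of \<open>m\<close>: as
  \<open>w\<close> is multiplicative and at most \<open>2\<close> at prime powers, the weight \<open>w(m\<^sub>1) w(m\<^sub>2)\<close> costs only a
  factor \<open>4\<close> in each local sum. Restricting the sum over the multiples of \<open>(q\<^sub>1, q\<^sub>2)\<close> to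
  \<open>N\<close>-smooth arguments gives a finite product of local sums, and \<open>N \<rightarrow> \<infinity>\<close> yields the Euler product.
\<close>

section \<open>Divisor sums and the Moebius function\<close>

text \<open>Both sides sum \<open>h d e\<close> over the pairs with \<open>d * e\<close> dividing
  \<open>n\<close>; the left one groups them by the product, the right one by
  \<open>d\<close>.\<close>

lemma sum_divisors_divisors:
  fixes h :: "nat \<Rightarrow> nat \<Rightarrow> 'a::comm_monoid_add"
  assumes "n > 0"
  shows "(\<Sum>m | m dvd n. \<Sum>d | d dvd m. h d (m div d)) = (\<Sum>d | d dvd n. \<Sum>e | e dvd n div d. h d e)"
proof -
  have fin: "finite {d. d dvd m}" if "m dvd n" for m
    using assms that by (intro finite_divisors_nat) (auto intro: Nat.gr0I)
  have fin': "finite {e. e dvd n div d}" if "d dvd n" for d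
    using assms that by (intro finite_divisors_nat) (auto elim!: dvdE)
  have "(\<Sum>m | m dvd n. \<Sum>d | d dvd m. h d (m div d)) =
      (\<Sum>(m, d)\<in>(SIGMA m:{m. m dvd n}. {d. d dvd m}). h d (m div d))"
    using fin assms by (subst sum.Sigma) auto
  also have "\<dots> = (\<Sum>(d, e)\<in>(SIGMA d:{d. d dvd n}. {e. e dvd n div d}). h d e)"
    using assms
    by (intro sum.reindex_bij_witness[of _ "\<lambda>(d, e). (d * e, d)" "\<lambda>(m, d). (d, m div d)"])
       (auto elim!: dvdE intro: dvd_trans)
  also have "\<dots> = (\<Sum>d | d dvd n. \<Sum>e | e dvd n div d. h d e)"
    using fin' assms by (subst sum.Sigma) auto
  finally show ?thesis .
qed

text \<open>By coprimality a divisor \<open>d\<close> of \<open>m * n\<close> splits uniquely, as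
  \<open>gcd d m * gcd d n\<close>.\<close>

lemma sum_divisors_mult_coprime:
  fixes F :: "nat \<Rightarrow> 'a::comm_monoid_add"
  assumes "coprime m n" "m > 0" "n > 0"
  shows "(\<Sum>d | d dvd m * n. F d) = (\<Sum>a | a dvd m. \<Sum>b | b dvd n. F (a * b))"
proof -
  have gcd1: "gcd (a * b) m = a" "gcd (a * b) n = b" if "a dvd m" "b dvd n" for a b
  proof -
    have "coprime m b" "coprime n a"
      using coprime_divisors[of m m b n] coprime_divisors[of a m n n] that assms
      by (simp_all add: coprime_commute)
    then show "gcd (a * b) m = a" "gcd (a * b) n = b"
      using that
      by (simp_all add: gcd_mult_left_right_cancel gcd_mult_left_left_cancel gcd_nat.absorb1)
  qed
  have gcd2: "gcd d m * gcd d n = d" if "d dvd m * n" for d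
    using that gcd1 by (elim dvd_productE) auto
  have "(\<Sum>a | a dvd m. \<Sum>b | b dvd n. F (a * b)) = (\<Sum>(a, b)\<in>{a. a dvd m} \<times> {b. b dvd n}. F (a * b))"
    by (simp add: sum.cartesian_product)
  also have "\<dots> = (\<Sum>d | d dvd m * n. F d)"
    by (intro sum.reindex_bij_witness[of _ "\<lambda>d. (gcd d m, gcd d n)" "\<lambda>(a, b). a * b"])
       (auto simp: gcd1 gcd2 mult_dvd_mono)
  finally show ?thesis ..
qed

lemma sum_divisors_prime_power:
  fixes F :: "nat \<Rightarrow> 'a::comm_monoid_add"
  assumes "prime p"
  shows "(\<Sum>d | d dvd p ^ k. F d) = (\<Sum>i\<le>k. F (p ^ i))"
proof -
  have "{d. d dvd p ^ k} = (\<lambda>i. p ^ i) ` {..k}"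
    using assms by (auto simp: divides_primepow_nat)
  moreover have "inj_on (\<lambda>i. p ^ i) {..k}"
    using prime_gt_1_nat[OF assms] by (intro inj_onI) simp
  ultimately show ?thesis
    by (simp add: sum.reindex)
qed

section \<open>Moebius inversion in one variable\<close>

lemma moebius_1 [simp]: "moebius (Suc 0) = 1"
  by (simp add: moebius_def)

lemma moebius_mult_coprime:
  assumes "coprime a b" "a > 0" "b > 0"
  shows "moebius (a * b) = moebius a * moebius b"
proof (cases "squarefree (a * b)")
  case True
  have "prime_factors a \<inter> prime_factors b = {}"
    using assms(1) by (auto simp: in_prime_factors_iff) (metis coprime_common_divisor not_prime_unit)
  then have "card (prime_factors (a * b)) = card (prime_factors a) + card (prime_factors b)"
    using assms by (simp add: prime_factors_product card_Un_disjoint)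
  with True show ?thesis
    by (auto simp: moebius_def power_add dest: squarefree_multD)
next
  case False
  then have "\<not> squarefree a \<or> \<not> squarefree b"
    using squarefree_mult_coprime[OF assms(1)] by blast
  with False show ?thesis by (auto simp: moebius_def)
qed

lemma moebius_prime_power:
  assumes "prime p"
  shows "moebius (p ^ k) = (if k = 0 then 1 else if k = 1 then -1 else 0)"
  using assms
  by (auto simp: moebius_def squarefree_power_iff prime_factorization_prime squarefree_prime
        prime_factorization_prime_power)

text \<open>Any prime divisor serves, taken to its full multiplicity so that the cofactor is coprime
  to it; \<open>Suc k\<close> records that the exponent is positive.\<close>

lemma nat_prime_power_decomp:
  assumes "n > (1::nat)"
  obtains p k m where "prime p" "n = p ^ Suc k * m" "coprime (p ^ Suc k) m" "m > 0"
proof -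
  obtain p where p: "prime p" "p dvd n"
    using assms prime_factor_nat[of n] by auto
  then obtain m where m: "n = p ^ multiplicity p n * m" "\<not> p dvd m"
    using assms multiplicity_decompose'[of n p] by (metis not_one_less_zero not_prime_unit)
  moreover have "multiplicity p n > 0"
    using p assms by (simp add: prime_multiplicity_gt_zero_iff)
  moreover have "m > 0" using m(2) by (auto intro: Nat.gr0I)
  moreover have "coprime (p ^ multiplicity p n) m"
    using p m by (simp add: prime_imp_coprime)
  ultimately show ?thesis
    using that[of p "multiplicity p n - 1" m] p by simp
qed

text \<open>For \<open>n > 1\<close>, splitting off the full power of one prime factors the sum, and
  the factor at that prime is zero.\<close>

lemma sum_moebius_divisors:
  assumes "n > 0"
  shows "(\<Sum>d | d dvd n. moebius d) = (if n = 1 then 1 else 0)"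
proof (cases "n = 1")
  case False
  then obtain p k m where *: "prime p" "n = p ^ Suc k * m" "coprime (p ^ Suc k) m" "m > 0"
    using nat_prime_power_decomp[of n] assms by auto
  have p0: "p ^ Suc k > 0" using \<open>prime p\<close> by (simp add: prime_gt_0_nat)
  have "(\<Sum>d | d dvd n. moebius d) = (\<Sum>a | a dvd p ^ Suc k. \<Sum>b | b dvd m. moebius (a * b))"
    unfolding *(2) using * p0 by (intro sum_divisors_mult_coprime)
  also have "\<dots> = (\<Sum>a | a dvd p ^ Suc k. \<Sum>b | b dvd m. moebius a * moebius b)"
  proof (intro sum.cong refl moebius_mult_coprime)
    fix a b assume "a \<in> {a. a dvd p ^ Suc k}" "b \<in> {b. b dvd m}"
    then have "a dvd p ^ Suc k" "b dvd m" by simp_all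
    with p0 * show "coprime a b" "a > 0" "b > 0"
      by (metis coprime_divisors, metis dvd_pos_nat, metis dvd_pos_nat)
  qed
  also have "\<dots> = (\<Sum>i\<le>Suc k. moebius (p ^ i)) * (\<Sum>b | b dvd m. moebius b)"
    by (simp only: sum_product sum_divisors_prime_power[OF \<open>prime p\<close>])
  \<comment> \<open>Exponents 0 and 1 both lie in the range because the exponent of \<open>p\<close>
    in \<open>n\<close> is \<open>Suc k\<close>; their terms 1 and -1 cancel.\<close>
  also have "(\<Sum>i\<le>Suc k. moebius (p ^ i)) = (\<Sum>i\<in>{0, 1}. moebius (p ^ i))"
    using *(1) by (intro sum.mono_neutral_right) (auto simp: moebius_prime_power)
  also have "\<dots> = 0"
    using moebius_prime_power[OF \<open>prime p\<close>, of 0] moebius_prime_power[OF \<open>prime p\<close>, of 1] by simp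
  finally show ?thesis using False by simp
qed simp

text \<open>After the interchange, \<open>F d\<close> is multiplied by the sum of the Moebius
  function over the divisors of \<open>n div d\<close>, which vanishes unless
  \<open>d = n\<close>.\<close>

lemma moebius_inversion:
  fixes F :: "nat \<Rightarrow> 'a::comm_ring_1"
  assumes "n > 0"
  shows "(\<Sum>m | m dvd n. \<Sum>d | d dvd m. F d * of_int (moebius (m div d))) = F n"
proof -
  have "(\<Sum>m | m dvd n. \<Sum>d | d dvd m. F d * of_int (moebius (m div d))) =
      (\<Sum>d | d dvd n. \<Sum>e | e dvd n div d. F d * of_int (moebius e))"
    using assms by (rule sum_divisors_divisors)
  also have "\<dots> = (\<Sum>d | d dvd n. F d * of_int (\<Sum>e | e dvd n div d. moebius e))"
    by (simp add: sum_distrib_left)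
  also have "\<dots> = (\<Sum>d | d dvd n. if d = n then F d else 0)"
    using assms by (intro sum.cong refl) (subst sum_moebius_divisors, auto elim!: dvdE)
  also have "\<dots> = F n"
    using assms by (subst sum.delta) (auto intro: finite_divisors_nat)
  finally show ?thesis .
qed

text \<open>By strong induction the proper divisors contribute equally to both sums, so the
  remaining terms at \<open>n\<close> agree. This serves to recover Ramanujan sums from their
  divisor sums.\<close>

lemma divisor_sums_eqD:
  fixes c c' :: "nat \<Rightarrow> 'a::ab_group_add"
  assumes "\<And>n. n > 0 \<Longrightarrow> (\<Sum>d | d dvd n. c d) = (\<Sum>d | d dvd n. c' d)" "n > 0"
  shows "c n = c' n"
  using assms(2)
proof (induction n rule: less_induct)
  case (less n)
  have fin: "finite {d. d dvd n}" using less.prems by (simp add: finite_divisors_nat)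
  have "(\<Sum>d\<in>{d. d dvd n} - {n}. c d) = (\<Sum>d\<in>{d. d dvd n} - {n}. c' d)"
    using less.prems by (intro sum.cong refl less.IH) (auto intro: Nat.gr0I dest: dvd_imp_le le_neq_implies_less)
  moreover have "(\<Sum>d | d dvd n. c d) = c n + (\<Sum>d\<in>{d. d dvd n} - {n}. c d)"
    "(\<Sum>d | d dvd n. c' d) = c' n + (\<Sum>d\<in>{d. d dvd n} - {n}. c' d)"
    using fin by (simp_all add: sum.remove)
  ultimately show ?case using assms(1)[OF less.prems] by simp
qed

text \<open>Since \<open>moebius2\<close> is a product of one-variable functions, inversion can be
  applied to the second variable and then to the first, once the sums over \<open>m2\<close> and
  \<open>d1\<close> are swapped.\<close>

lemma sum_divisors_dirichlet_conv2_moebius2: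
  assumes "n1 > 0" "n2 > 0"
  shows "(\<Sum>m1 | m1 dvd n1. \<Sum>m2 | m2 dvd n2. dirichlet_conv2 f moebius2 m1 m2) = f n1 n2"
proof -
  let ?h = "\<lambda>m1 d1 m2. \<Sum>d2 | d2 dvd m2. f d1 d2 * of_int (moebius (m2 div d2)) * of_int (moebius (m1 div d1))"
  have "(\<Sum>m1 | m1 dvd n1. \<Sum>m2 | m2 dvd n2. dirichlet_conv2 f moebius2 m1 m2) =
     (\<Sum>m1 | m1 dvd n1. \<Sum>m2 | m2 dvd n2. \<Sum>d1 | d1 dvd m1. ?h m1 d1 m2)"
    unfolding dirichlet_conv2_def moebius2_def by (intro sum.cong refl) (simp add: mult_ac)
  also have "\<dots> = (\<Sum>m1 | m1 dvd n1. \<Sum>d1 | d1 dvd m1. \<Sum>m2 | m2 dvd n2. ?h m1 d1 m2)"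
    by (intro sum.cong refl sum.swap)
  also have "\<dots> = (\<Sum>m1 | m1 dvd n1. \<Sum>d1 | d1 dvd m1.
        (\<Sum>m2 | m2 dvd n2. \<Sum>d2 | d2 dvd m2. f d1 d2 * of_int (moebius (m2 div d2))) *
          of_int (moebius (m1 div d1)))"
    by (simp only: sum_distrib_right)
  also have "\<dots> = f n1 n2"
    using assms by (simp add: moebius_inversion moebius_inversion[of n1 "\<lambda>d. f d n2"])
  finally show ?thesis .
qed

lemma dirichlet_conv2_1: "dirichlet_conv2 f moebius2 (Suc 0) (Suc 0) = f 1 1"
  by (simp add: dirichlet_conv2_def moebius2_def)

text \<open>Divisors of \<open>m1 * n1\<close> and \<open>m2 * n2\<close> split along the coprime
  factors, and both \<open>f\<close> and the Moebius function factor along that splitting.\<close>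

lemma multiplicative2_dirichlet_conv2_moebius2:
  assumes f: "multiplicative2 f"
  shows "multiplicative2 (dirichlet_conv2 f moebius2)"
  unfolding multiplicative2_def
proof (intro allI impI)
  fix m1 m2 n1 n2 :: nat
  assume pos: "m1 > 0" "m2 > 0" "n1 > 0" "n2 > 0" and "coprime (m1 * m2) (n1 * n2)"
  then have cop: "coprime m1 n1" "coprime m2 n2" "coprime m1 n2" "coprime m2 n1" by auto
  have *: "f (a1 * b1) (a2 * b2) * moebius2 (m1 * n1 div (a1 * b1)) (m2 * n2 div (a2 * b2)) =
      (f a1 a2 * moebius2 (m1 div a1) (m2 div a2)) * (f b1 b2 * moebius2 (n1 div b1) (n2 div b2))"
    if d: "a1 dvd m1" "b1 dvd n1" "a2 dvd m2" "b2 dvd n2" for a1 a2 b1 b2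
  proof -
    have pos': "a1 > 0" "b1 > 0" "a2 > 0" "b2 > 0"
      "m1 div a1 > 0" "n1 div b1 > 0" "m2 div a2 > 0" "n2 div b2 > 0"
      using d pos by (auto intro!: Nat.gr0I elim!: dvdE)
    \<comment> \<open>The two-variable condition mixes the coordinates: a divisor of
      \<open>m1\<close> must be coprime to divisors of \<open>n2\<close> as well as of
      \<open>n1\<close>.\<close>
    have cop': "coprime x y" if "x dvd m1 \<or> x dvd m2" "y dvd n1 \<or> y dvd n2" for x y
      using that cop by (meson coprime_divisors)
    have dd: "m1 div a1 dvd m1" "m2 div a2 dvd m2" "n1 div b1 dvd n1" "n2 div b2 dvd n2"
      using d by (auto elim!: dvdE)
    have "f (a1 * b1) (a2 * b2) = f a1 a2 * f b1 b2"
      using f pos' d cop' unfolding multiplicative2_def by simp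
    moreover have "m1 * n1 div (a1 * b1) = (m1 div a1) * (n1 div b1)"
      "m2 * n2 div (a2 * b2) = (m2 div a2) * (n2 div b2)"
      using d by (simp_all add: div_mult_div_if_dvd)
    moreover have "moebius ((m1 div a1) * (n1 div b1)) = moebius (m1 div a1) * moebius (n1 div b1)"
      "moebius ((m2 div a2) * (n2 div b2)) = moebius (m2 div a2) * moebius (n2 div b2)"
      using pos' d cop' by (auto intro!: moebius_mult_coprime dd)
    ultimately show ?thesis by (simp add: moebius2_def mult_ac)
  qed
  let ?t = "\<lambda>d1 d2. f d1 d2 * moebius2 (m1 * n1 div d1) (m2 * n2 div d2)"
  have "dirichlet_conv2 f moebius2 (m1 * n1) (m2 * n2) =
      (\<Sum>a1 | a1 dvd m1. \<Sum>b1 | b1 dvd n1. \<Sum>a2 | a2 dvd m2. \<Sum>b2 | b2 dvd n2. ?t (a1 * b1) (a2 * b2))"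
    unfolding dirichlet_conv2_def using pos cop by (simp add: sum_divisors_mult_coprime)
  also have "\<dots> = (\<Sum>a1 | a1 dvd m1. \<Sum>b1 | b1 dvd n1. \<Sum>a2 | a2 dvd m2. \<Sum>b2 | b2 dvd n2.
      (f a1 a2 * moebius2 (m1 div a1) (m2 div a2)) * (f b1 b2 * moebius2 (n1 div b1) (n2 div b2)))"
    using * by (intro sum.cong refl) auto
  also have "\<dots> = (\<Sum>a1 | a1 dvd m1. \<Sum>b1 | b1 dvd n1.
      (\<Sum>a2 | a2 dvd m2. f a1 a2 * moebius2 (m1 div a1) (m2 div a2)) *
      (\<Sum>b2 | b2 dvd n2. f b1 b2 * moebius2 (n1 div b1) (n2 div b2)))"
    by (simp only: sum_product)
  also have "\<dots> = dirichlet_conv2 f moebius2 m1 m2 * dirichlet_conv2 f moebius2 n1 n2"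
    unfolding dirichlet_conv2_def by (simp only: sum_product)
  finally show "dirichlet_conv2 f moebius2 (m1 * n1) (m2 * n2) =
      dirichlet_conv2 f moebius2 m1 m2 * dirichlet_conv2 f moebius2 n1 n2" .
qed

section \<open>Ramanujan sums\<close>

text \<open>The value is \<open>2\<close> to the number of prime factors of \<open>n\<close>.\<close>

definition squarefree_divisor_count :: "nat \<Rightarrow> real" where
  "squarefree_divisor_count n = (\<Sum>d | d dvd n. of_int \<bar>moebius d\<bar>)"

lemma squarefree_divisor_count_1 [simp]: "squarefree_divisor_count (Suc 0) = 1"
  by (simp add: squarefree_divisor_count_def)

lemma squarefree_divisor_count_nonneg: "squarefree_divisor_count n \<ge> 0"
  by (simp add: squarefree_divisor_count_def sum_nonneg)

lemma squarefree_divisor_count_mono: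
  assumes "m dvd n" "n > 0"
  shows "squarefree_divisor_count m \<le> squarefree_divisor_count n"
  unfolding squarefree_divisor_count_def
  using assms by (intro sum_mono2) (auto intro: dvd_trans finite_divisors_nat)

lemma squarefree_divisor_count_ge_1:
  assumes "n > 0"
  shows "squarefree_divisor_count n \<ge> 1"
  using squarefree_divisor_count_mono[of 1 n] assms by simp

lemma squarefree_divisor_count_mult_coprime:
  assumes "coprime m n" "m > 0" "n > 0"
  shows "squarefree_divisor_count (m * n) = squarefree_divisor_count m * squarefree_divisor_count n"
proof -
  have "squarefree_divisor_count (m * n) =
      (\<Sum>a | a dvd m. \<Sum>b | b dvd n. of_int \<bar>moebius (a * b)\<bar>)"
    unfolding squarefree_divisor_count_def using assms by (rule sum_divisors_mult_coprime)
  also have "\<dots> = (\<Sum>a | a dvd m. \<Sum>b | b dvd n. of_int \<bar>moebius a\<bar> * of_int \<bar>moebius b\<bar>)"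
  proof (intro sum.cong refl)
    fix a b assume "a \<in> {a. a dvd m}" "b \<in> {b. b dvd n}"
    then have "a dvd m" "b dvd n" by simp_all
    then have "moebius (a * b) = moebius a * moebius b"
      using assms by (intro moebius_mult_coprime) (metis coprime_divisors, metis dvd_pos_nat, metis dvd_pos_nat)
    then show "of_int \<bar>moebius (a * b)\<bar> = (of_int \<bar>moebius a\<bar> * of_int \<bar>moebius b\<bar> :: real)"
      by (simp add: abs_mult)
  qed
  also have "\<dots> = squarefree_divisor_count m * squarefree_divisor_count n"
    by (simp add: squarefree_divisor_count_def sum_product)
  finally show ?thesis .
qed

lemma squarefree_divisor_count_prime_power_le:
  assumes "prime p"
  shows "squarefree_divisor_count (p ^ k) \<le> 2"
proof -
  have "squarefree_divisor_count (p ^ k) = (\<Sum>i\<le>k. of_int \<bar>moebius (p ^ i)\<bar>)"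
    unfolding squarefree_divisor_count_def using assms by (rule sum_divisors_prime_power)
  \<comment> \<open>Extending the range to \<open>Suc k\<close> puts exponents 0 and 1 both in it,
    even for \<open>k = 0\<close>.\<close>
  also have "\<dots> \<le> (\<Sum>i\<le>Suc k. of_int \<bar>moebius (p ^ i)\<bar>)"
    by (intro sum_mono2) auto
  also have "\<dots> = (\<Sum>i\<in>{0, 1}. of_int \<bar>moebius (p ^ i)\<bar>)"
    using assms by (intro sum.mono_neutral_right) (auto simp: moebius_prime_power simp del: power_Suc)
  also have "\<dots> = 2"
    using moebius_prime_power[OF assms, of 0] moebius_prime_power[OF assms, of 1] by simp
  finally show ?thesis .
qed

text \<open>The union over \<open>q\<close> of the reduced fractions with denominator
  \<open>q\<close> is the set of all fractions \<open>a / m\<close>, so the sum is a full geometric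
  sum of powers of exp(2 pi i n / m).\<close>

lemma sum_ramanujan_sum_divisors:
  assumes "m > 0"
  shows "(\<Sum>q | q dvd m. ramanujan_sum q n) = (if m dvd n then of_nat m else 0)"
proof -
  define E :: "nat \<Rightarrow> nat \<Rightarrow> complex"
    where "E q a = exp (2 * of_real pi * \<i> * of_nat a * of_nat n / of_nat q)" for q a
  define R :: "nat \<Rightarrow> nat set" where "R q = {a. 1 \<le> a \<and> a \<le> q \<and> coprime a q}" for q
  define w where "w = E m 1"
  have "(\<Sum>q | q dvd m. ramanujan_sum q n) = (\<Sum>(q, b)\<in>(SIGMA q:{q. q dvd m}. R q). E q b)"
    using assms finite_subset[of "R _" "{.._}"]
    by (subst sum.Sigma[symmetric]) (auto simp: ramanujan_sum_def E_def R_def finite_divisors_nat)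
  \<comment> \<open>\<open>E\<close> depends only on the fraction: reducing \<open>a / m\<close> to
    lowest terms gives \<open>b / q\<close>, and expanding \<open>b / q\<close> to denominator
    \<open>m\<close> goes back.\<close>
  also have "\<dots> = (\<Sum>a=1..m. E m a)"
  proof (rule sum.reindex_bij_witness[of _ "\<lambda>a. (m div gcd a m, a div gcd a m)" "\<lambda>(q, b). b * (m div q)"])
    fix x assume "x \<in> (SIGMA q:{q. q dvd m}. R q)"
    then obtain q b where x: "x = (q, b)" "q dvd m" "1 \<le> b" "b \<le> q" "coprime b q"
      by (auto simp: R_def)
    then obtain c where c: "m = q * c" by blast
    then have pos: "c > 0" "q > 0" using assms by (auto intro: Nat.gr0I)
    have "gcd (b * c) (q * c) = c"
      using x by (metis coprime_imp_gcd_eq_1 gcd_mult_distrib_nat mult.commute mult.right_neutral)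
    with x c pos show "(m div gcd (case x of (q, b) \<Rightarrow> b * (m div q)) m,
        (case x of (q, b) \<Rightarrow> b * (m div q)) div gcd (case x of (q, b) \<Rightarrow> b * (m div q)) m) = x"
      by simp
    show "(case x of (q, b) \<Rightarrow> b * (m div q)) \<in> {1..m}"
      using x c pos by simp
    show "E m (case x of (q, b) \<Rightarrow> b * (m div q)) = (case x of (q, b) \<Rightarrow> E q b)"
      using x c pos by (simp add: E_def field_simps)
  next
    fix a assume a: "a \<in> {1..m}"
    then show "(case (m div gcd a m, a div gcd a m) of (q, b) \<Rightarrow> b * (m div q)) = a"
      using assms by (simp add: div_div_eq_right)
    have "coprime (a div gcd a m) (m div gcd a m)"
      using assms by (intro div_gcd_coprime) auto
    moreover have "a div gcd a m > 0" "a div gcd a m \<le> m div gcd a m"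
      using a assms by (auto simp: div_greater_zero_iff gcd_le1_nat intro: div_le_mono)
    moreover have "m div gcd a m dvd m"
      by (metis dvd_div_mult_self dvd_triv_left gcd_dvd2)
    ultimately show "(m div gcd a m, a div gcd a m) \<in> (SIGMA q:{q. q dvd m}. R q)"
      by (auto simp: R_def)
  qed
  also have "\<dots> = (\<Sum>a=1..m. w ^ a)"
    unfolding w_def E_def by (intro sum.cong refl) (simp add: exp_of_nat_mult[symmetric] mult_ac)
  also have "\<dots> = (if m dvd n then of_nat m else 0)"
  proof (cases "m dvd n")
    case True
    then obtain k where k: "n = m * k" by blast
    have "w = exp (2 * of_real pi * \<i> * of_nat k)"
      using assms by (simp add: w_def E_def k field_simps)
    also have "\<dots> = 1"
      using exp_integer_2pi[of "of_nat k"] by (simp add: mult_ac)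
    finally show ?thesis using True by simp
  next
    case False
    have "w ^ m = exp (2 * of_real pi * \<i> * of_nat n)"
      using assms unfolding w_def E_def by (simp add: exp_of_nat_mult[symmetric])
    also have "\<dots> = 1"
      using exp_integer_2pi[of "of_nat n"] by (simp add: mult_ac)
    finally have wm: "w ^ m = 1" .
    have "w \<noteq> 1"
    proof
      assume "w = 1"
      then obtain k :: int where "2 * pi * real n / real m = of_int (2 * k) * pi"
        by (auto simp: w_def E_def exp_eq_1)
      then have "real n = of_int k * real m"
        using assms by (simp add: field_simps)
      then have "int n = k * int m"
        by (metis of_int_eq_iff of_int_mult of_int_of_nat_eq)
      then have "int m dvd int n" by simp
      with False show False by simp
    qed
    moreover have "(\<Sum>a=1..m. w ^ a) = w * (\<Sum>a<m. w ^ a)"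
      by (simp add: sum_distrib_left sum.atLeast1_atMost_eq)
    ultimately show ?thesis
      using False wm by (simp add: geometric_sum)
  qed
  finally show ?thesis .
qed

text \<open>Both sides have the same sum over the divisors of every positive integer, the right one
  by Moebius inversion, so they agree.\<close>

lemma ramanujan_sum_eq_sum_moebius:
  assumes "q > 0"
  shows "ramanujan_sum q n =
    (\<Sum>d | d dvd q. (if d dvd n then of_nat d else 0) * of_int (moebius (q div d)))"
  using _ assms
  by (rule divisor_sums_eqD) (simp add: sum_ramanujan_sum_divisors moebius_inversion)

text \<open>The triangle inequality in the Moebius formula leaves, after interchanging, a sum over
  common divisors \<open>d\<close> of \<open>m\<close> and \<open>n\<close> of \<open>d\<close>
  times the count for \<open>m div d\<close>, which is at most the count for \<open>m\<close>. The
  first factor does not grow with \<open>m\<close>.\<close>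

lemma sum_norm_ramanujan_sum_le:
  assumes "m > 0" "n > 0"
  shows "(\<Sum>q | q dvd m. norm (ramanujan_sum q n)) \<le>
    (\<Sum>d | d dvd n. real d) * squarefree_divisor_count m"
proof -
  let ?F = "\<lambda>d. if d dvd n then real d else 0"
  have norm_F: "norm (if d dvd n then of_nat d else 0 :: complex) = ?F d" for d
    by simp
  have "(\<Sum>q | q dvd m. norm (ramanujan_sum q n)) \<le>
      (\<Sum>q | q dvd m. \<Sum>d | d dvd q. ?F d * of_int \<bar>moebius (q div d)\<bar>)"
  proof (intro sum_mono)
    fix q assume "q \<in> {q. q dvd m}"
    then have "q > 0" using assms by (auto intro: Nat.gr0I)
    show "norm (ramanujan_sum q n) \<le> (\<Sum>d | d dvd q. ?F d * of_int \<bar>moebius (q div d)\<bar>)"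
      unfolding ramanujan_sum_eq_sum_moebius[OF \<open>q > 0\<close>]
      by (rule order_trans[OF norm_sum]) (simp only: norm_mult norm_F norm_of_int of_int_abs order_refl)
  qed
  also have "\<dots> = (\<Sum>d | d dvd m. ?F d * squarefree_divisor_count (m div d))"
    unfolding squarefree_divisor_count_def sum_distrib_left
    using assms(1) by (rule sum_divisors_divisors)
  also have "\<dots> \<le> (\<Sum>d | d dvd m. ?F d * squarefree_divisor_count m)"
    using assms by (intro sum_mono mult_left_mono squarefree_divisor_count_mono) (auto elim!: dvdE)
  also have "\<dots> = (\<Sum>d\<in>{d. d dvd m} \<inter> {d. d dvd n}. real d) * squarefree_divisor_count m"
    using assms by (simp add: sum_distrib_right sum.inter_restrict finite_divisors_nat if_distrib if_distribR cong: if_cong)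
  also have "\<dots> \<le> (\<Sum>d | d dvd n. real d) * squarefree_divisor_count m"
    using assms
    by (intro mult_right_mono sum_mono2 squarefree_divisor_count_nonneg) (auto simp: finite_divisors_nat)
  finally show ?thesis .
qed

section \<open>Euler products in two variables\<close>

text \<open>Dominated convergence: the Weierstrass M-test makes the finite partial sums converge
  uniformly in \<open>n\<close>, so the two limits may be exchanged. The filter is arbitrary because
  both integer sequences and pairs of real variables occur later.\<close>

lemma tendsto_infsum_dominated:
  fixes f :: "'a \<Rightarrow> 'b \<Rightarrow> 'c::banach" and M :: "'b \<Rightarrow> real"
  assumes bound: "\<And>x n. x \<in> A \<Longrightarrow> norm (f n x) \<le> M x"
    and M: "M summable_on A"
    and lim: "\<And>x. x \<in> A \<Longrightarrow> ((\<lambda>n. f n x) \<longlongrightarrow> g x) F"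
  shows "((\<lambda>n. infsum (f n) A) \<longlongrightarrow> infsum g A) F"
proof (cases "F = bot")
  case False
  have "norm (g x) \<le> M x" if "x \<in> A" for x
    by (rule tendsto_upperbound[OF tendsto_norm[OF lim[OF that]]])
       (use bound[OF that] False in auto)
  then have "g summable_on A"
    by (rule abs_summable_summable[OF Infinite_Sum.abs_summable_on_comparison_test'[OF M]])
  then have g: "(sum g \<longlongrightarrow> infsum g A) (finite_subsets_at_top A)"
    using has_sum_infsum by (auto simp: has_sum_def)
  have unif: "uniform_limit UNIV (\<lambda>X n. \<Sum>x\<in>X. f n x) (\<lambda>n. \<Sum>\<^sub>\<infinity>x\<in>A. f n x) (finite_subsets_at_top A)"
    using bound M by (intro Weierstrass_m_test_general) auto
  show ?thesis
    using _ g unif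
  proof (rule swap_uniform_limit')
    show "\<forall>\<^sub>F X in finite_subsets_at_top A. ((\<lambda>n. \<Sum>x\<in>X. f n x) \<longlongrightarrow> sum g X) F"
      using lim by (intro eventually_finite_subsets_at_top_weakI tendsto_sum) auto
  qed auto
qed simp

text \<open>Summability of complex families is absolute, so the product family is summable over the
  product set, and its sum can then be evaluated one variable at a time.\<close>

lemma has_sum_times:
  fixes f :: "'a \<Rightarrow> complex" and g :: "'b \<Rightarrow> complex"
  assumes f: "(f has_sum a) A" and g: "(g has_sum b) B"
  shows "((\<lambda>(x, y). f x * g y) has_sum a * b) (A \<times> B)"
proof -
  have "f summable_on A" "g summable_on B"
    using f g by (auto simp: summable_on_def)
  then have nf: "(\<lambda>x. norm (f x)) summable_on A" and ng: "(\<lambda>x. norm (g x)) summable_on B"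
    by (simp_all flip: summable_on_iff_abs_summable_on_complex)
  have "(\<lambda>z. norm (case z of (x, y) \<Rightarrow> f x * g y)) summable_on A \<times> B"
  proof (rule summable_on_SigmaI)
    show "((\<lambda>y. norm (case (x, y) of (x, y) \<Rightarrow> f x * g y)) has_sum norm (f x) * infsum (\<lambda>y. norm (g y)) B) B" for x
      using has_sum_infsum[OF ng] by (auto simp: norm_mult intro: has_sum_cmult_right)
    show "(\<lambda>x. norm (f x) * infsum (\<lambda>y. norm (g y)) B) summable_on A"
      using nf by (rule summable_on_cmult_left)
  qed auto
  then have "(\<lambda>(x, y). f x * g y) summable_on A \<times> B"
    by (rule abs_summable_summable)
  then have S: "((\<lambda>(x, y). f x * g y) has_sum infsum (\<lambda>(x, y). f x * g y) (A \<times> B)) (A \<times> B)"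
    by (rule has_sum_infsum)
  then have "((\<lambda>x. f x * b) has_sum infsum (\<lambda>(x, y). f x * g y) (A \<times> B)) A"
    by (rule has_sum_SigmaD) (use g in \<open>auto intro: has_sum_cmult_right\<close>)
  moreover have "((\<lambda>x. f x * b) has_sum a * b) A"
    using f by (rule has_sum_cmult_left)
  ultimately show ?thesis
    using S by (metis has_sum_unique)
qed

text \<open>
  If \<open>k p\<close> is the exponent of \<open>p\<close> in \<open>q\<close> and \<open>P\<close> contains the prime factors of \<open>q\<close>, these are the
  \<open>P\<close>-smooth multiples of \<open>q\<close>. For \<open>P\<close> not containing them, only the exponents at \<open>P\<close> are constrained,
  which is what the induction on \<open>P\<close> needs.
\<close>

definition smooth_multiples :: "nat set \<Rightarrow> (nat \<Rightarrow> nat) \<Rightarrow> nat set" where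
  "smooth_multiples P k = {m. m > 0 \<and> prime_factors m \<subseteq> P \<and> (\<forall>p\<in>P. k p \<le> multiplicity p m)}"

section \<open>Finite Euler products over smooth numbers\<close>

lemma smooth_multiples_empty: "smooth_multiples {} k = {1}"
  by (auto simp: smooth_multiples_def prime_factorization_empty_iff)

lemma coprime_smooth_prime_power:
  assumes "prime p" "p \<notin> P" "m > (0::nat)" "prime_factors m \<subseteq> P"
  shows "coprime m (p ^ e)" "multiplicity p m = 0"
proof -
  have "\<not> p dvd m"
    using assms by (auto simp: in_prime_factors_iff)
  then show "coprime m (p ^ e)" "multiplicity p m = 0"
    using prime_imp_coprime[OF assms(1)] by (auto simp: coprime_commute not_dvd_imp_multiplicity_0)
qed

text \<open>One direction of the bijection that adds the prime \<open>p\<close> to \<open>P\<close>: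
  as \<open>p\<close> does not divide \<open>m\<close>, the exponent \<open>e\<close> can be read
  off again.\<close>

lemma smooth_multiples_mult_prime_power:
  assumes P: "\<And>p. p \<in> P \<Longrightarrow> prime p" and p: "prime p" "p \<notin> P"
    and m: "m \<in> smooth_multiples P k" and e: "e \<ge> k p"
  shows "m * p ^ e \<in> smooth_multiples (insert p P) k" "multiplicity p (m * p ^ e) = e"
proof -
  have m0: "m > 0" "prime_factors m \<subseteq> P" using m by (auto simp: smooth_multiples_def)
  have p0: "p > 0" using p by (simp add: prime_gt_0_nat)
  have mult: "multiplicity q (m * p ^ e) = multiplicity q m + (if q = p then e else 0)" if "prime q" for q
    using that p m0 p0 by (simp add: prime_elem_multiplicity_mult_distrib multiplicity_distinct_prime_power)
  show "multiplicity p (m * p ^ e) = e"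
    using mult p coprime_smooth_prime_power[OF p m0] by simp
  have "prime_factors (m * p ^ e) \<subseteq> insert p P"
    using m0 p0 p prime_dvd_power primes_dvd_imp_eq
    by (auto simp: prime_factors_product subset_iff in_prime_factors_iff) blast
  moreover have "k q \<le> multiplicity q (m * p ^ e)" if "q \<in> insert p P" for q
    using that m e P p mult[of q] coprime_smooth_prime_power[OF p m0]
    by (auto simp: smooth_multiples_def intro: le_trans)
  ultimately show "m * p ^ e \<in> smooth_multiples (insert p P) k"
    using m0 p0 by (auto simp: smooth_multiples_def)
qed

text \<open>The inverse direction: removing the full power of \<open>p\<close> leaves the
  multiplicities at the primes of \<open>P\<close> unchanged.\<close>

lemma smooth_multiples_insertE:
  assumes P: "\<And>p. p \<in> P \<Longrightarrow> prime p" and p: "prime p" "p \<notin> P"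
    and n: "n \<in> smooth_multiples (insert p P) k"
  shows "n div p ^ multiplicity p n \<in> smooth_multiples P k" "k p \<le> multiplicity p n"
proof -
  have n0: "n > 0" "prime_factors n \<subseteq> insert p P" using n by (auto simp: smooth_multiples_def)
  have p0: "p > 0" using p by (simp add: prime_gt_0_nat)
  show "k p \<le> multiplicity p n" using n by (simp add: smooth_multiples_def)
  obtain m where m: "n = p ^ multiplicity p n * m" "\<not> p dvd m"
    using multiplicity_decompose'[of n p] n0 p by (metis not_prime_unit less_numeral_extra(3))
  have m0: "m > 0" using m(2) by (auto intro: Nat.gr0I)
  have "n div p ^ multiplicity p n = m"
    using p0 by (subst m(1)) simp
  moreover have "m \<in> smooth_multiples P k"
    unfolding smooth_multiples_def
  proof (intro CollectI conjI ballI)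
    have "q \<in> P" if "q \<in> prime_factors m" for q
    proof -
      have "q dvd n" using that m(1) by (metis dvd_mult in_prime_factors_iff)
      then have "q \<in> insert p P" using that n0 by (auto simp: in_prime_factors_iff)
      moreover have "q \<noteq> p" using that m(2) by auto
      ultimately show ?thesis by simp
    qed
    then show "prime_factors m \<subseteq> P" by auto
    fix q assume q: "q \<in> P"
    have "multiplicity q n = multiplicity q (p ^ multiplicity p n) + multiplicity q m"
      using P[OF q] m0 p0 by (subst m(1)) (simp add: prime_elem_multiplicity_mult_distrib)
    also have "\<dots> = multiplicity q m"
      using P[OF q] q p by (simp, subst multiplicity_distinct_prime_power) auto
    finally show "k q \<le> multiplicity q m" using n q by (auto simp: smooth_multiples_def)
  qed (use m0 in simp)
  ultimately show "n div p ^ multiplicity p n \<in> smooth_multiples P k" by simp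
qed

text \<open>Induction on \<open>P\<close>: adding a prime \<open>p\<close> multiplies each
  coordinate by an independent power of \<open>p\<close>, along which \<open>G\<close> factors by
  coprimality, so the sum factors too.\<close>

lemma has_sum_smooth_multiples:
  fixes G :: "nat \<Rightarrow> nat \<Rightarrow> complex"
  assumes G: "multiplicative2 G" "G 1 1 = 1"
    and "finite P" "\<And>p. p \<in> P \<Longrightarrow> prime p"
    and "\<And>p. p \<in> P \<Longrightarrow> (\<lambda>(e1, e2). G (p ^ e1) (p ^ e2)) summable_on UNIV"
  shows "((\<lambda>(m1, m2). G m1 m2) has_sum
      (\<Prod>p\<in>P. \<Sum>\<^sub>\<infinity>(e1, e2)\<in>{k1 p..} \<times> {k2 p..}. G (p ^ e1) (p ^ e2)))
      (smooth_multiples P k1 \<times> smooth_multiples P k2)"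
  using assms(3-)
proof (induction P rule: finite_induct)
  case empty
  show ?case using G(2) by (intro has_sum_finiteI) (simp_all add: smooth_multiples_empty)
next
  case (insert p P)
  let ?S = "smooth_multiples P" and ?L = "\<lambda>p. \<Sum>\<^sub>\<infinity>(e1, e2)\<in>{k1 p..} \<times> {k2 p..}. G (p ^ e1) (p ^ e2)"
  let ?i = "\<lambda>(n1, n2). ((n1 div p ^ multiplicity p n1, n2 div p ^ multiplicity p n2),
           (multiplicity p n1, multiplicity p n2))"
  let ?j = "\<lambda>((m1, m2), (e1, e2)). (m1 * p ^ e1, m2 * p ^ e2)"
  let ?G = "\<lambda>(m1, m2). G m1 m2" and ?g = "\<lambda>(e1, e2). G (p ^ e1) (p ^ e2)"
  have P: "\<And>q. q \<in> P \<Longrightarrow> prime q" and p: "prime p" "p \<notin> P" using insert by auto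
  have p0: "p > 0" using p by (simp add: prime_gt_0_nat)
  have "(\<lambda>(e1, e2). G (p ^ e1) (p ^ e2)) summable_on {k1 p..} \<times> {k2 p..}"
    using insert.prems(2)[of p] by (rule summable_on_subset_banach) auto
  then have "((\<lambda>(e1, e2). G (p ^ e1) (p ^ e2)) has_sum ?L p) ({k1 p..} \<times> {k2 p..})"
    by (rule has_sum_infsum)
  moreover have "((\<lambda>(m1, m2). G m1 m2) has_sum (\<Prod>p\<in>P. ?L p)) (?S k1 \<times> ?S k2)"
    using insert by blast
  ultimately have "((\<lambda>(x, y). ?G x * ?g y) has_sum (\<Prod>p\<in>P. ?L p) * ?L p) ((?S k1 \<times> ?S k2) \<times> ({k1 p..} \<times> {k2 p..}))"
    by (intro has_sum_times)
  also have "?this \<longleftrightarrow> ((\<lambda>(m1, m2). G m1 m2) has_sum ?L p * (\<Prod>p\<in>P. ?L p))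
      (smooth_multiples (insert p P) k1 \<times> smooth_multiples (insert p P) k2)"
  proof (rule has_sum_reindex_bij_witness[of _ ?i ?j])
    fix a assume "a \<in> (?S k1 \<times> ?S k2) \<times> ({k1 p..} \<times> {k2 p..})"
    then obtain m1 m2 e1 e2 where a: "a = ((m1, m2), (e1, e2))" "m1 \<in> ?S k1" "m2 \<in> ?S k2"
      "e1 \<ge> k1 p" "e2 \<ge> k2 p" by auto
    note sm = smooth_multiples_mult_prime_power[OF P p a(2,4)]
      smooth_multiples_mult_prime_power[OF P p a(3,5)]
    show "?i (?j a) = a"
      using sm(2,4) p0 by (simp add: a)
    show "?j a \<in> smooth_multiples (insert p P) k1 \<times> smooth_multiples (insert p P) k2"
      using sm(1,3) by (simp add: a)
    have "m1 > 0" "m2 > 0" "prime_factors m1 \<subseteq> P" "prime_factors m2 \<subseteq> P"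
      using a by (auto simp: smooth_multiples_def)
    then have "G (m1 * p ^ e1) (m2 * p ^ e2) = G m1 m2 * G (p ^ e1) (p ^ e2)"
      using G(1) p0 coprime_smooth_prime_power[OF p, of m1] coprime_smooth_prime_power[OF p, of m2]
      unfolding multiplicative2_def by simp
    then show "?G (?j a) = (\<lambda>(x, y). ?G x * ?g y) a"
      by (simp add: a)
  next
    fix b assume "b \<in> smooth_multiples (insert p P) k1 \<times> smooth_multiples (insert p P) k2"
    then obtain n1 n2 where b: "b = (n1, n2)"
      "n1 \<in> smooth_multiples (insert p P) k1" "n2 \<in> smooth_multiples (insert p P) k2" by auto
    show "?i b \<in> (?S k1 \<times> ?S k2) \<times> ({k1 p..} \<times> {k2 p..})"
      using smooth_multiples_insertE[OF P p b(2)] smooth_multiples_insertE[OF P p b(3)] by (simp add: b)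
    show "?j (?i b) = b"
      by (simp add: b multiplicity_dvd dvd_div_mult_self)
  qed (simp add: mult.commute)
  finally show ?case using insert by simp
qed

text \<open>Summing over the exponents first yields \<open>s\<close>. It omits the pair
  \<open>(0, 0)\<close>, whose term is the same for all primes; the last part puts it back.\<close>

lemma has_sum_norm_prime_powers:
  fixes G :: "nat \<Rightarrow> nat \<Rightarrow> complex"
  assumes sum: "(\<lambda>(p, e1, e2). norm (G (p ^ e1) (p ^ e2)))
      summable_on (SIGMA p:{p. prime p}. {(e1, e2). e1 + e2 \<ge> 1})"
  defines "s \<equiv> \<lambda>p. \<Sum>\<^sub>\<infinity>(e1, e2)\<in>{(e1, e2). e1 + e2 \<ge> 1}. norm (G (p ^ e1) (p ^ e2))"
  shows "s summable_on {p. prime p}"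
    and "prime p \<Longrightarrow> ((\<lambda>(e1, e2). norm (G (p ^ e1) (p ^ e2))) has_sum s p) {(e1, e2). e1 + e2 \<ge> 1}"
    and "prime p \<Longrightarrow> ((\<lambda>(e1, e2). norm (G (p ^ e1) (p ^ e2))) has_sum norm (G 1 1) + s p) UNIV"
proof -
  let ?g = "\<lambda>p (e1, e2). norm (G (p ^ e1) (p ^ e2))"
  have sum': "(\<lambda>(p, e). ?g p e) summable_on (SIGMA p:{p. prime p}. {(e1, e2). e1 + e2 \<ge> 1})"
    using sum by (simp add: case_prod_unfold)
  show 1: "(?g p has_sum s p) {(e1, e2). e1 + e2 \<ge> 1}" if "prime p" for p
    using summable_on_SigmaD1[OF sum', of p] that by (auto simp: s_def intro: has_sum_infsum)
  have "(s has_sum infsum (\<lambda>(p, e). ?g p e) (SIGMA p:{p. prime p}. {(e1, e2). e1 + e2 \<ge> 1})) {p. prime p}"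
    by (rule has_sum_SigmaD[OF has_sum_infsum[OF sum']]) (use 1 in auto)
  then show "s summable_on {p. prime p}"
    by (auto simp: summable_on_def)
  have UNIV: "(UNIV :: (nat \<times> nat) set) = insert (0, 0) {(e1, e2). e1 + e2 \<ge> 1}"
    by auto
  show "(?g p has_sum norm (G 1 1) + s p) UNIV" if "prime p"
    unfolding UNIV using has_sum_insert[OF _ 1[OF that], of "(0, 0)"] by simp
qed

text \<open>A finite set of pairs involves finitely many primes, so a finite Euler product of norms
  bounds its sum; 1 + x \<le> exp x makes the bound independent of the set.\<close>

lemma multiplicative2_abs_summable:
  fixes G :: "nat \<Rightarrow> nat \<Rightarrow> complex"
  assumes G: "multiplicative2 G" "G 1 1 = 1"
    and sum: "(\<lambda>(p, e1, e2). norm (G (p ^ e1) (p ^ e2)))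
      summable_on (SIGMA p:{p. prime p}. {(e1, e2). e1 + e2 \<ge> 1})"
  shows "(\<lambda>(m1, m2). norm (G m1 m2)) summable_on {1..} \<times> {1..}"
proof -
  define s where "s = (\<lambda>p. \<Sum>\<^sub>\<infinity>(e1, e2)\<in>{(e1, e2). e1 + e2 \<ge> 1}. norm (G (p ^ e1) (p ^ e2)))"
  have s: "s summable_on {p. prime p}"
    and L: "\<And>p. prime p \<Longrightarrow> ((\<lambda>(e1, e2). norm (G (p ^ e1) (p ^ e2))) has_sum 1 + s p) UNIV"
    using has_sum_norm_prime_powers(1,3)[of G, OF sum] G(2) by (simp_all add: s_def)
  have s_nonneg: "s p \<ge> 0" for p
    unfolding s_def by (intro infsum_nonneg) auto
  \<comment> \<open>The norms are regarded as complex numbers so that the finite Euler product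
    applies to them.\<close>
  define H :: "nat \<Rightarrow> nat \<Rightarrow> complex" where "H m n = of_real (norm (G m n))" for m n
  have H: "multiplicative2 H" "H 1 1 = 1"
    using G by (simp_all add: H_def multiplicative2_def norm_mult)
  have LH: "((\<lambda>(e1, e2). H (p ^ e1) (p ^ e2)) has_sum of_real (1 + s p)) UNIV" if "prime p" for p
    using has_sum_of_real[OF L[OF that], where ?'a = complex] by (simp add: H_def case_prod_unfold)
  show ?thesis
  proof (rule nonneg_bdd_above_summable_on)
    show "bdd_above (sum (\<lambda>(m1, m2). norm (G m1 m2)) ` {F. F \<subseteq> {1..} \<times> {1..} \<and> finite F})"
    proof (rule bdd_aboveI2)
      fix F :: "(nat \<times> nat) set" assume "F \<in> {F. F \<subseteq> {1..} \<times> {1..} \<and> finite F}"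
      then have F: "F \<subseteq> {1..} \<times> {1..}" "finite F" by auto
      define P where "P = (\<Union>(m1, m2)\<in>F. prime_factors m1 \<union> prime_factors m2)"
      have P: "finite P" "\<And>p. p \<in> P \<Longrightarrow> prime p"
        using F by (auto simp: P_def)
      \<comment> \<open>The exponent bound 0 is no constraint, so these are all pairs of
        \<open>P\<close>-smooth numbers.\<close>
      define A where "A = smooth_multiples P (\<lambda>_. 0) \<times> smooth_multiples P (\<lambda>_. 0)"
      have "F \<subseteq> A"
        using F unfolding A_def P_def smooth_multiples_def by fastforce
      have "((\<lambda>(m1, m2). H m1 m2) has_sum
          (\<Prod>p\<in>P. \<Sum>\<^sub>\<infinity>(e1, e2)\<in>{0..} \<times> {0..}. H (p ^ e1) (p ^ e2))) A"
        unfolding A_def using P by (intro has_sum_smooth_multiples H has_sum_imp_summable[OF LH]) auto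
      also have "(\<Prod>p\<in>P. \<Sum>\<^sub>\<infinity>(e1, e2)\<in>{0..} \<times> {0..}. H (p ^ e1) (p ^ e2)) = of_real (\<Prod>p\<in>P. 1 + s p)"
        unfolding of_real_prod using LH P by (intro prod.cong refl) (auto intro: infsumI)
      finally have "((\<lambda>(m1, m2). norm (G m1 m2)) has_sum (\<Prod>p\<in>P. 1 + s p)) A"
        by (simp add: H_def case_prod_unfold has_sum_of_real_iff del: of_real_prod)
      then have "(\<Sum>(m1, m2)\<in>F. norm (G m1 m2)) \<le> (\<Prod>p\<in>P. 1 + s p)"
        using \<open>F \<subseteq> A\<close> F by (intro finite_sum_le_has_sum) auto
      also have "\<dots> \<le> (\<Prod>p\<in>P. exp (s p))"
        using s_nonneg by (intro prod_mono) auto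
      also have "\<dots> = exp (\<Sum>p\<in>P. s p)"
        using P by (simp add: exp_sum)
      also have "(\<Sum>p\<in>P. s p) \<le> infsum s {p. prime p}"
        using P s s_nonneg by (intro finite_sum_le_infsum) auto
      finally show "(\<Sum>(m1, m2)\<in>F. norm (G m1 m2)) \<le> exp (infsum s {p. prime p})"
        by simp
    qed
  qed auto
qed

text \<open>For large \<open>N\<close> the partial product is the sum of \<open>G\<close> over pairs
  of \<open>N\<close>-smooth multiples. These exhaust all multiples, and the norm of
  \<open>G\<close> dominates.\<close>

lemma tendsto_euler_product:
  fixes G :: "nat \<Rightarrow> nat \<Rightarrow> complex"
  assumes G: "multiplicative2 G" "G 1 1 = 1"
    and sum: "(\<lambda>(p, e1, e2). norm (G (p ^ e1) (p ^ e2)))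
      summable_on (SIGMA p:{p. prime p}. {(e1, e2). e1 + e2 \<ge> 1})"
    and q: "q1 > 0" "q2 > 0"
  shows "(\<lambda>N. \<Prod>p | prime p \<and> p \<le> N. \<Sum>\<^sub>\<infinity>(e1, e2)\<in>{multiplicity p q1..} \<times> {multiplicity p q2..}.
           G (p ^ e1) (p ^ e2)) \<longlonglongrightarrow>
         (\<Sum>\<^sub>\<infinity>(m1, m2)\<in>{m. m > 0 \<and> q1 dvd m} \<times> {m. m > 0 \<and> q2 dvd m}. G m1 m2)"
proof -
  let ?L = "\<lambda>p. \<Sum>\<^sub>\<infinity>(e1, e2)\<in>{multiplicity p q1..} \<times> {multiplicity p q2..}. G (p ^ e1) (p ^ e2)"
  let ?P = "\<lambda>N. {p::nat. prime p \<and> p \<le> N}"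
  let ?S = "\<lambda>q N. smooth_multiples (?P N) (\<lambda>p. multiplicity p q)"
  let ?A = "{m. m > 0 \<and> q1 dvd m} \<times> {m. m > 0 \<and> q2 dvd m}"
  \<comment> \<open>Extension by zero keeps the index set fixed while \<open>N\<close>
    varies.\<close>
  let ?f = "\<lambda>N x. if x \<in> ?S q1 N \<times> ?S q2 N then G (fst x) (snd x) else 0"
  have S_in: "m \<in> ?S q N" if "m > 0" "q dvd m" "m \<le> N" for m q N
    using that unfolding smooth_multiples_def
    by (auto simp: in_prime_factors_iff intro: dvd_imp_le[THEN order_trans] dvd_imp_multiplicity_le)
  \<comment> \<open>For \<open>q \<le> N\<close> every prime factor of \<open>q\<close> is at most
    \<open>N\<close>, so the exponent conditions up to \<open>N\<close> already force divisibility
    by \<open>q\<close>.\<close>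
  have S_dvd: "m > 0 \<and> q dvd m" if "m \<in> ?S q N" "q > 0" "q \<le> N" for m q N
  proof -
    have m: "m > 0" "\<And>p. prime p \<Longrightarrow> p \<le> N \<Longrightarrow> multiplicity p q \<le> multiplicity p m"
      using that by (auto simp: smooth_multiples_def)
    have "multiplicity p q \<le> multiplicity p m" if "prime p" for p
    proof (cases "p dvd q")
      case True
      then show ?thesis using m that \<open>q > 0\<close> \<open>q \<le> N\<close> by (meson dvd_imp_le order_trans)
    qed (simp add: not_dvd_imp_multiplicity_0)
    then have "q dvd m"
      using m(1) that(2) by (intro multiplicity_le_imp_dvd) auto
    with m show ?thesis by simp
  qed
  have "(\<lambda>N. infsum (?f N) ?A) \<longlonglongrightarrow> infsum (\<lambda>x. G (fst x) (snd x)) ?A"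
  proof (rule tendsto_infsum_dominated)
    show "(\<lambda>x. norm (G (fst x) (snd x))) summable_on ?A"
      using summable_on_subset_banach[OF multiplicative2_abs_summable[OF G sum], of ?A]
      by (simp add: case_prod_unfold subset_iff)
  next
    fix x assume x: "x \<in> ?A"
    have "\<forall>\<^sub>F N in sequentially. N \<ge> fst x \<and> N \<ge> snd x"
      by (intro eventually_conj eventually_ge_at_top)
    then have "\<forall>\<^sub>F N in sequentially. ?f N x = G (fst x) (snd x)"
      by eventually_elim (use x S_in in auto)
    then show "(\<lambda>N. ?f N x) \<longlonglongrightarrow> G (fst x) (snd x)"
      by (rule tendsto_eventually)
  qed auto
  moreover have "\<forall>\<^sub>F N in sequentially. infsum (?f N) ?A = (\<Prod>p\<in>?P N. ?L p)"
    using eventually_ge_at_top[of q1] eventually_ge_at_top[of q2]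
  proof eventually_elim
    case (elim N)
    have "(\<lambda>(e1, e2). G (p ^ e1) (p ^ e2)) summable_on UNIV" if "prime p" for p
      by (rule abs_summable_summable)
         (use has_sum_imp_summable[OF has_sum_norm_prime_powers(3)[of G, OF sum that]] in \<open>simp add: case_prod_unfold\<close>)
    then have "((\<lambda>(m1, m2). G m1 m2) has_sum (\<Prod>p\<in>?P N. ?L p)) (?S q1 N \<times> ?S q2 N)"
      by (intro has_sum_smooth_multiples G) auto
    also have "?this \<longleftrightarrow> (?f N has_sum (\<Prod>p\<in>?P N. ?L p)) ?A"
    proof (rule has_sum_cong_neutral)
      fix x assume "x \<in> ?S q1 N \<times> ?S q2 N - ?A"
      then have False using S_dvd[OF _ q(1) elim(1)] S_dvd[OF _ q(2) elim(2)] by blast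
      then show "(\<lambda>(m1, m2). G m1 m2) x = 0" ..
    qed (auto simp: case_prod_unfold)
    finally show ?case by (rule infsumI)
  qed
  ultimately show ?thesis
    by (simp add: case_prod_unfold filterlim_cong)
qed

section \<open>The expansion\<close>

text \<open>This is the \<open>G\<close> of the opening comment.\<close>

definition rf_weight :: "(nat \<Rightarrow> nat \<Rightarrow> complex) \<Rightarrow> nat \<Rightarrow> nat \<Rightarrow> complex" where
  "rf_weight f m1 m2 = dirichlet_conv2 f moebius2 m1 m2 / of_nat (m1 * m2)"

text \<open>Pairing any argument with \<open>(1, 1)\<close> gives
  \<open>f m n = f 1 1 * f m n\<close>, so \<open>f 1 1\<close> is idempotent, and if it is 0 then
  \<open>f\<close> vanishes on positive arguments.\<close>

lemma multiplicative2_11: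
  assumes "multiplicative2 f"
  obtains "f 1 1 = 1" | "\<And>m n. m > 0 \<Longrightarrow> n > 0 \<Longrightarrow> f m n = 0"
proof -
  have *: "f m n = f 1 1 * f m n" if "m > 0" "n > 0" for m n
    using assms[unfolded multiplicative2_def, rule_format, of 1 1 m n] that by simp
  have "f 1 1 * f 1 1 = f 1 1"
    using *[of 1 1] by simp
  then have "f 1 1 = 1 \<or> f 1 1 = 0" by auto
  then show ?thesis
    using * that by force
qed

lemma multiplicative2_rf_weight:
  assumes "multiplicative2 f"
  shows "multiplicative2 (rf_weight f)"
  using multiplicative2_dirichlet_conv2_moebius2[OF assms]
  by (simp add: multiplicative2_def rf_weight_def)

lemma rf_weight_11: "rf_weight f 1 1 = f 1 1"
  by (simp add: rf_weight_def dirichlet_conv2_1)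

lemma rf_weight_prime_power:
  "rf_weight f (p ^ e1) (p ^ e2) = dirichlet_conv2 f moebius2 (p ^ e1) (p ^ e2) / of_nat (p ^ (e1 + e2))"
  by (simp add: rf_weight_def power_add)

lemma local_sum_eq:
  "local_sum f p k1 k2 = (\<Sum>\<^sub>\<infinity>(e1, e2)\<in>{k1..} \<times> {k2..}. rf_weight f (p ^ e1) (p ^ e2))"
  by (simp add: local_sum_def rf_weight_prime_power)

text \<open>The weighted function is again multiplicative, so summability over prime powers
  suffices, and there the weights are bounded.\<close>

lemma rf_weight_weighted_summable:
  assumes f: "multiplicative2 f"
    and sum: "(\<lambda>(p, e1, e2). norm (rf_weight f (p ^ e1) (p ^ e2)))
      summable_on (SIGMA p:{p. prime p}. {(e1, e2). e1 + e2 \<ge> 1})"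
  shows "(\<lambda>(m1, m2). squarefree_divisor_count m1 * squarefree_divisor_count m2 * norm (rf_weight f m1 m2))
    summable_on {1..} \<times> {1..}"
proof -
  let ?w = squarefree_divisor_count
  define W where "W m1 m2 = of_real (?w m1 * ?w m2) * rf_weight f m1 m2" for m1 m2
  have norm_W: "norm (W m1 m2) = ?w m1 * ?w m2 * norm (rf_weight f m1 m2)" for m1 m2
    by (simp add: W_def norm_mult squarefree_divisor_count_nonneg)
  note mult = multiplicative2_rf_weight[OF f]
  show ?thesis
  proof (rule multiplicative2_11[OF mult])
    assume 1: "rf_weight f 1 1 = 1"
    have "(\<lambda>(m1, m2). norm (W m1 m2)) summable_on {1..} \<times> {1..}"
    proof (rule multiplicative2_abs_summable)
      show "multiplicative2 W"
        using mult unfolding multiplicative2_def W_def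
        by (simp add: squarefree_divisor_count_mult_coprime mult_ac)
      show "W 1 1 = 1" using 1 by (simp add: W_def)
      have "(\<lambda>x. norm (case x of (p, e1, e2) \<Rightarrow> W (p ^ e1) (p ^ e2)))
          summable_on (SIGMA p:{p. prime p}. {(e1, e2). e1 + e2 \<ge> 1})"
      proof (rule Infinite_Sum.abs_summable_on_comparison_test'[OF summable_on_cmult_right[OF sum, of 4]])
        fix x :: "nat \<times> nat \<times> nat"
        assume "x \<in> (SIGMA p:{p. prime p}. {(e1, e2). e1 + e2 \<ge> 1})"
        then obtain p e1 e2 where x: "x = (p, e1, e2)" "prime p" by (cases x) auto
        \<comment> \<open>Each coordinate contributes at most 2 at a prime power, whence the
          constant 4.\<close>
        have "?w (p ^ e1) * ?w (p ^ e2) \<le> 2 * 2"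
          using x by (intro mult_mono squarefree_divisor_count_prime_power_le squarefree_divisor_count_nonneg) auto
        then show "norm (case x of (p, e1, e2) \<Rightarrow> W (p ^ e1) (p ^ e2)) \<le>
            4 * (case x of (p, e1, e2) \<Rightarrow> norm (rf_weight f (p ^ e1) (p ^ e2)))"
          by (simp add: x norm_W mult_right_mono)
      qed
      then show "(\<lambda>(p, e1, e2). norm (W (p ^ e1) (p ^ e2)))
          summable_on (SIGMA p:{p. prime p}. {(e1, e2). e1 + e2 \<ge> 1})"
        by (simp add: case_prod_unfold)
    qed
    then show ?thesis by (simp add: norm_W)
  next
    assume 0: "\<And>m n. m > 0 \<Longrightarrow> n > 0 \<Longrightarrow> rf_weight f m n = 0"
    show ?thesis
      by (rule summable_on_cong[THEN iffD2, OF _ summable_on_0[of _ "\<lambda>_. 0"]]) (auto simp: 0)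
  qed
qed

lemma rf_term_eq: "rf_term f q1 q2 (m1, m2) = rf_weight f (m1 * q1) (m2 * q2)"
  by (simp add: rf_term_def rf_weight_def mult_ac)

text \<open>The substitution of \<open>m1 * q1\<close> and \<open>m2 * q2\<close> moves the
  dependence on \<open>q1\<close> and \<open>q2\<close> from the summand to the index set, the form
  needed for the interchange and the Euler product.\<close>

lemma has_sum_rf_term_iff:
  assumes "q1 > 0" "q2 > 0"
  shows "(rf_term f q1 q2 has_sum S) ({1..} \<times> {1..}) \<longleftrightarrow>
    ((\<lambda>(m1, m2). rf_weight f m1 m2) has_sum S) ({m. m > 0 \<and> q1 dvd m} \<times> {m. m > 0 \<and> q2 dvd m})"
proof (rule has_sum_reindex_bij_witness[of _ "\<lambda>(n1, n2). (n1 div q1, n2 div q2)" "\<lambda>(m1, m2). (m1 * q1, m2 * q2)"])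
  have "n div q \<ge> 1" if "n > 0" "q dvd n" for n q :: nat
    using that by (auto elim!: dvdE simp: Suc_le_eq)
  then show "(case b of (n1, n2) \<Rightarrow> (n1 div q1, n2 div q2)) \<in> {1..} \<times> {1..}"
    if "b \<in> {m. m > 0 \<and> q1 dvd m} \<times> {m. m > 0 \<and> q2 dvd m}" for b
    using that by auto
qed (use assms in \<open>auto simp: rf_term_eq\<close>)

text \<open>\<open>H\<close> is summed in two orders over the pairs \<open>(m, q)\<close> in which
  \<open>q\<close> divides \<open>m\<close> in each coordinate: fixing \<open>m\<close> leaves a
  finite sum that can be evaluated, fixing \<open>q\<close> produces the coefficient.\<close>

lemma ramanujan_fourier_expansion:
  assumes sum: "(\<lambda>(m1, m2). squarefree_divisor_count m1 * squarefree_divisor_count m2 * norm (rf_weight f m1 m2))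
    summable_on {1..} \<times> {1..}"
    and coeff: "\<And>q1 q2. q1 > 0 \<Longrightarrow> q2 > 0 \<Longrightarrow>
      ((\<lambda>(m1, m2). rf_weight f m1 m2) has_sum a q1 q2) ({m. m > 0 \<and> q1 dvd m} \<times> {m. m > 0 \<and> q2 dvd m})"
    and n: "n1 > 0" "n2 > 0"
  shows "((\<lambda>(q1, q2). a q1 q2 * ramanujan_sum q1 n1 * ramanujan_sum q2 n2) has_sum f n1 n2) ({1..} \<times> {1..})"
proof -
  let ?w = squarefree_divisor_count
  let ?N = "{1..} \<times> {1..} :: (nat \<times> nat) set"
  let ?D = "\<lambda>m. {q. q dvd fst m} \<times> {q. q dvd snd m} :: (nat \<times> nat) set"
  let ?M = "\<lambda>q. {m. m > 0 \<and> fst q dvd m} \<times> {m. m > 0 \<and> snd q dvd m} :: (nat \<times> nat) set"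
  define c where "c q = ramanujan_sum (fst q) n1 * ramanujan_sum (snd q) n2" for q
  define G where "G m = rf_weight f (fst m) (snd m)" for m
  define H where "H x = G (fst x) * c (snd x)" for x
  have finD: "finite (?D m)" if "m \<in> ?N" for m
    using that by (auto intro!: finite_divisors_nat)
  have sum_c: "(\<Sum>q\<in>?D m. c q) = (if fst m dvd n1 \<and> snd m dvd n2 then of_nat (fst m * snd m) else 0)"
    if "m \<in> ?N" for m
  proof -
    have "(\<Sum>q\<in>?D m. c q) = (\<Sum>q | q dvd fst m. ramanujan_sum q n1) * (\<Sum>q | q dvd snd m. ramanujan_sum q n2)"
      by (simp add: c_def sum_product sum.cartesian_product case_prod_unfold)
    also have "\<dots> = (if fst m dvd n1 \<and> snd m dvd n2 then of_nat (fst m * snd m) else 0)"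
      using that by (auto simp: sum_ramanujan_sum_divisors)
    finally show ?thesis .
  qed
  define K where "K = (\<Sum>d | d dvd n1. real d) * (\<Sum>d | d dvd n2. real d)"
  have sum_norm_c: "(\<Sum>q\<in>?D m. norm (c q)) \<le> K * (?w (fst m) * ?w (snd m))" if "m \<in> ?N" for m
  proof -
    have "(\<Sum>q\<in>?D m. norm (c q)) =
        (\<Sum>q | q dvd fst m. norm (ramanujan_sum q n1)) * (\<Sum>q | q dvd snd m. norm (ramanujan_sum q n2))"
      by (simp add: c_def norm_mult sum_product sum.cartesian_product case_prod_unfold)
    also have "\<dots> \<le> ((\<Sum>d | d dvd n1. real d) * ?w (fst m)) * ((\<Sum>d | d dvd n2. real d) * ?w (snd m))"
      using that n
      by (intro mult_mono sum_norm_ramanujan_sum_le mult_nonneg_nonneg squarefree_divisor_count_nonneg sum_nonneg) auto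
    finally show ?thesis by (simp add: K_def mult_ac)
  qed
  \<comment> \<open>Here the weights enter: for fixed \<open>m\<close> the norms of the Ramanujan
    sums add up to at most a constant times the weight of \<open>m\<close>.\<close>
  have "(\<lambda>x. norm (H x)) summable_on (SIGMA m:?N. ?D m)"
  proof (rule summable_on_SigmaI)
    show "((\<lambda>q. norm (H (m, q))) has_sum norm (G m) * (\<Sum>q\<in>?D m. norm (c q))) (?D m)" if "m \<in> ?N" for m
      using finD[OF that] by (intro has_sum_finiteI) (simp_all add: H_def norm_mult sum_distrib_left)
    have "(\<lambda>m. norm (norm (G m) * (\<Sum>q\<in>?D m. norm (c q)))) summable_on ?N"
    proof (rule Infinite_Sum.abs_summable_on_comparison_test'[OF summable_on_cmult_right[OF sum, of K]])
      fix m assume "m \<in> ?N"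
      from mult_left_mono[OF sum_norm_c[OF this], of "norm (G m)"]
      show "norm (norm (G m) * (\<Sum>q\<in>?D m. norm (c q))) \<le>
          K * (case m of (m1, m2) \<Rightarrow> ?w m1 * ?w m2 * norm (rf_weight f m1 m2))"
        by (simp add: G_def case_prod_unfold abs_mult sum_nonneg mult_ac)
    qed
    then show "(\<lambda>m. norm (G m) * (\<Sum>q\<in>?D m. norm (c q))) summable_on ?N"
      by (simp add: abs_mult sum_nonneg)
  qed auto
  then have "H summable_on (SIGMA m:?N. ?D m)"
    by (rule abs_summable_summable)
  then obtain S where S: "(H has_sum S) (SIGMA m:?N. ?D m)"
    by (auto simp: summable_on_def)
  have "((\<lambda>m. G m * (\<Sum>q\<in>?D m. c q)) has_sum S) ?N"
    by (rule has_sum_SigmaD[OF S])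
       (use finD in \<open>auto intro!: has_sum_finiteI simp: H_def sum_distrib_left\<close>)
  \<comment> \<open>Only \<open>m\<close> dividing \<open>(n1, n2)\<close> coordinatewise survive;
    the inner sum cancels the denominator of \<open>G\<close>, and Moebius inversion
    finishes.\<close>
  moreover have "((\<lambda>m. G m * (\<Sum>q\<in>?D m. c q)) has_sum f n1 n2) ?N"
  proof (rule has_sum_finite_neutralI)
    let ?B = "{m. m dvd n1} \<times> {m. m dvd n2}"
    show "finite ?B" using n by (simp add: finite_divisors_nat)
    show B: "?B \<subseteq> ?N" using n by (auto simp: Suc_le_eq intro: dvd_pos_nat)
    show "G m * (\<Sum>q\<in>?D m. c q) = 0" if "m \<in> ?N - ?B" for m
      using that sum_c[of m] by auto
    have "(\<Sum>m\<in>?B. G m * (\<Sum>q\<in>?D m. c q)) = (\<Sum>m\<in>?B. dirichlet_conv2 f moebius2 (fst m) (snd m))"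
    proof (intro sum.cong refl)
      fix m assume m: "m \<in> ?B"
      with B have "m \<in> ?N" by blast
      with m sum_c[of m] show "G m * (\<Sum>q\<in>?D m. c q) = dirichlet_conv2 f moebius2 (fst m) (snd m)"
        by (auto simp: G_def rf_weight_def)
    qed
    also have "\<dots> = f n1 n2"
      using sum_divisors_dirichlet_conv2_moebius2[OF n, of f]
      by (simp add: sum.cartesian_product case_prod_unfold)
    finally show "f n1 n2 = (\<Sum>m\<in>?B. G m * (\<Sum>q\<in>?D m. c q))" ..
  qed
  ultimately have "S = f n1 n2" by (rule has_sum_unique)
  \<comment> \<open>The same pairs listed with \<open>q\<close> first; positivity of
    \<open>q\<close> follows from \<open>q\<close> dividing a positive \<open>m\<close>.\<close>
  moreover have "(H has_sum S) (SIGMA m:?N. ?D m) \<longleftrightarrow>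
      ((\<lambda>(q, m). H (m, q)) has_sum S) (SIGMA q:?N. ?M q)"
  proof -
    have "q > 0" if "m > 0" "q dvd m" for q m :: nat
      using that by (rule dvd_pos_nat)
    then have mem: "(b, a) \<in> (SIGMA q:?N. ?M q) \<longleftrightarrow> (a, b) \<in> (SIGMA m:?N. ?D m)" for a b
      by (cases a; cases b) (auto simp: Suc_le_eq)
    show ?thesis
    proof (rule has_sum_reindex_bij_witness[of _ prod.swap prod.swap])
      show "prod.swap x \<in> (SIGMA q:?N. ?M q)" if "x \<in> (SIGMA m:?N. ?D m)" for x
        using that mem[of "snd x" "fst x"] by (simp only: prod.swap_def prod.collapse)
      show "prod.swap x \<in> (SIGMA m:?N. ?D m)" if "x \<in> (SIGMA q:?N. ?M q)" for x
        using that mem[of "fst x" "snd x"] by (simp only: prod.swap_def prod.collapse)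
    qed (simp_all only: swap_swap prod.swap_def case_prod_unfold fst_conv snd_conv prod.collapse)
  qed
  ultimately have "((\<lambda>(q, m). H (m, q)) has_sum f n1 n2) (SIGMA q:?N. ?M q)"
    using S by simp
  then have "((\<lambda>q. a (fst q) (snd q) * c q) has_sum f n1 n2) ?N"
  proof (rule has_sum_SigmaD)
    fix q assume "q \<in> ?N"
    then have "(G has_sum a (fst q) (snd q)) (?M q)"
      using coeff[of "fst q" "snd q"] by (auto simp: G_def[abs_def] case_prod_unfold)
    then show "((\<lambda>m. case (q, m) of (q, m) \<Rightarrow> H (m, q)) has_sum a (fst q) (snd q) * c q) (?M q)"
      by (auto simp: H_def intro: has_sum_cmult_left)
  qed
  then show ?thesis by (simp add: c_def case_prod_unfold mult_ac)
qed

section \<open>The mean value and the product formula\<close>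

text \<open>Each positive \<open>m\<close> has exactly \<open>N div m\<close> multiples in
  \<open>{1..N}\<close>.\<close>

lemma sum_divisor_sums:
  fixes F :: "nat \<Rightarrow> complex"
  shows "(\<Sum>n=1..N. \<Sum>m | m dvd n. F m) = (\<Sum>m=1..N. F m * of_nat (N div m))"
proof -
  have "(\<Sum>n=1..N. \<Sum>m | m dvd n. F m) = (\<Sum>n=1..N. \<Sum>m=1..N. if m dvd n then F m else 0)"
  proof (rule sum.cong[OF refl])
    fix n assume n: "n \<in> {1..N}"
    then have "{m. m dvd n} = {m \<in> {1..N}. m dvd n}"
      by (auto simp: Suc_le_eq intro: dvd_pos_nat dest: dvd_imp_le[THEN order_trans])
    then show "(\<Sum>m | m dvd n. F m) = (\<Sum>m=1..N. if m dvd n then F m else 0)"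
      by (simp only: sum.inter_filter finite_atLeastAtMost)
  qed
  also have "\<dots> = (\<Sum>m=1..N. \<Sum>n=1..N. if m dvd n then F m else 0)"
    by (rule sum.swap)
  also have "\<dots> = (\<Sum>m=1..N. F m * of_nat (N div m))"
  proof (intro sum.cong refl)
    fix m assume m: "m \<in> {1..N}"
    have "{n \<in> {1..N}. m dvd n} = (\<lambda>k. m * k) ` {1..N div m}"
    proof (intro set_eqI iffI)
      fix n assume "n \<in> {n \<in> {1..N}. m dvd n}"
      then obtain k where "n = m * k" "1 \<le> m * k" "m * k \<le> N" by auto
      with m show "n \<in> (\<lambda>k. m * k) ` {1..N div m}"
        by (auto simp: less_eq_div_iff_mult_less_eq mult.commute Suc_le_eq)
    next
      fix n assume "n \<in> (\<lambda>k. m * k) ` {1..N div m}"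
      then obtain k where "n = m * k" "k \<in> {1..N div m}" by blast
      then have k: "n = m * k" "1 \<le> k" "k \<le> N div m" by simp_all
      then have "m * k \<le> N" using m by (simp add: less_eq_div_iff_mult_less_eq mult.commute)
      with k m show "n \<in> {n \<in> {1..N}. m dvd n}" by auto
    qed
    moreover have "inj_on (\<lambda>k. m * k) {1..N div m}"
      using m by (intro inj_onI) auto
    ultimately have "card {n \<in> {1..N}. m dvd n} = N div m"
      by (simp add: card_image)
    then show "(\<Sum>n=1..N. if m dvd n then F m else 0) = F m * of_nat (N div m)"
      by (simp only: sum.inter_filter[symmetric] finite_atLeastAtMost) (simp add: mult.commute)
  qed
  finally show ?thesis .
qed

text \<open>Moebius inversion writes \<open>f\<close> as a divisor sum in both variables; multiples
  are then counted in each.\<close>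

lemma sum_eq_sum_dirichlet_conv2:
  "(\<Sum>n1=1..N1. \<Sum>n2=1..N2. f n1 n2) =
     (\<Sum>m1=1..N1. \<Sum>m2=1..N2. dirichlet_conv2 f moebius2 m1 m2 * of_nat (N1 div m1) * of_nat (N2 div m2))"
proof -
  let ?g = "dirichlet_conv2 f moebius2"
  have "(\<Sum>n1=1..N1. \<Sum>n2=1..N2. f n1 n2) =
      (\<Sum>n1=1..N1. \<Sum>n2=1..N2. \<Sum>m1 | m1 dvd n1. \<Sum>m2 | m2 dvd n2. ?g m1 m2)"
    by (intro sum.cong refl sum_divisors_dirichlet_conv2_moebius2[symmetric]) auto
  also have "\<dots> = (\<Sum>n1=1..N1. \<Sum>m1 | m1 dvd n1. \<Sum>n2=1..N2. \<Sum>m2 | m2 dvd n2. ?g m1 m2)"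
    by (intro sum.cong refl sum.swap)
  also have "\<dots> = (\<Sum>m1=1..N1. \<Sum>m2=1..N2. ?g m1 m2 * of_nat (N1 div m1) * of_nat (N2 div m2))"
    by (simp only: sum_divisor_sums) (simp add: sum_distrib_left sum_distrib_right mult_ac)
  finally show ?thesis .
qed

text \<open>The guard \<open>x > 0\<close> keeps the ratio in \<open>[0, 1]\<close> for every \<open>x\<close>, as dominated convergence requires.\<close>

definition multiples_ratio :: "nat \<Rightarrow> real \<Rightarrow> real" where
  "multiples_ratio m x = (if x > 0 then real (m * (nat \<lfloor>x\<rfloor> div m)) / x else 0)"

lemma multiples_ratio_bounds: "0 \<le> multiples_ratio m x" "multiples_ratio m x \<le> 1"
proof -
  show "0 \<le> multiples_ratio m x" by (simp add: multiples_ratio_def)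
  have "real (m * (nat \<lfloor>x\<rfloor> div m)) \<le> x" if "x > 0"
  proof -
    have "real (m * (nat \<lfloor>x\<rfloor> div m)) \<le> real (nat \<lfloor>x\<rfloor>)"
      by (simp only: of_nat_le_iff times_div_less_eq_dividend)
    also have "\<dots> \<le> x" using that by simp
    finally show ?thesis .
  qed
  then show "multiples_ratio m x \<le> 1" by (simp add: multiples_ratio_def)
qed

lemma multiples_ratio_tendsto:
  assumes "m > 0"
  shows "(multiples_ratio m \<longlongrightarrow> 1) at_top"
proof (rule tendsto_sandwich[OF _ _ _ tendsto_const])
  have "((\<lambda>x. inverse x) \<longlongrightarrow> (0::real)) at_top"
    by (rule tendsto_inverse_0_at_top) (rule filterlim_ident)
  from tendsto_diff[OF tendsto_const tendsto_mult[OF tendsto_const this], of 1 "1 + real m"]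
  show "((\<lambda>x. 1 - (1 + real m) * inverse x) \<longlongrightarrow> 1) at_top" by simp
  show "\<forall>\<^sub>F x in at_top. 1 - (1 + real m) * inverse x \<le> multiples_ratio m x"
    using eventually_gt_at_top[of 0]
  proof eventually_elim
    case (elim x)
    \<comment> \<open>Rounding \<open>x\<close> down to an integer loses at most 1 and rounding
      further to a multiple of \<open>m\<close> at most \<open>m\<close>, whence the constant
      \<open>1 + m\<close>.\<close>
    have "nat \<lfloor>x\<rfloor> = m * (nat \<lfloor>x\<rfloor> div m) + nat \<lfloor>x\<rfloor> mod m" by simp
    moreover have "nat \<lfloor>x\<rfloor> mod m \<le> m" using assms by (simp add: less_imp_le)
    ultimately have "nat \<lfloor>x\<rfloor> \<le> m * (nat \<lfloor>x\<rfloor> div m) + m" by linarith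
    then have "real (nat \<lfloor>x\<rfloor>) \<le> real (m * (nat \<lfloor>x\<rfloor> div m) + m)"
      by (simp only: of_nat_le_iff)
    moreover have "x - 1 \<le> real (nat \<lfloor>x\<rfloor>)" using elim by linarith
    ultimately have "x - (1 + real m) \<le> real (m * (nat \<lfloor>x\<rfloor> div m))" by simp
    then have "(x - (1 + real m)) / x \<le> real (m * (nat \<lfloor>x\<rfloor> div m)) / x"
      using elim by (intro divide_right_mono) auto
    then show ?case using elim by (simp add: multiples_ratio_def field_simps)
  qed
qed (simp add: multiples_ratio_bounds)

text \<open>For positive \<open>x\<close> and \<open>y\<close> the average is the sum of
  \<open>rf_weight f\<close> times one ratio per variable. The ratios lie in [0, 1] and tend to 1,
  so dominated convergence applies as \<open>x\<close> and \<open>y\<close> grow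
  independently.\<close>

lemma mean_value_eq_infsum:
  assumes sum: "(\<lambda>(m1, m2). norm (rf_weight f m1 m2)) summable_on {1..} \<times> {1..}"
  shows "mean_value f = (\<Sum>\<^sub>\<infinity>(m1, m2)\<in>{1..} \<times> {1..}. rf_weight f m1 m2)"
proof -
  let ?N = "{1..} \<times> {1..} :: (nat \<times> nat) set"
  let ?F = "at_top \<times>\<^sub>F at_top :: (real \<times> real) filter"
  define T where "T z m = rf_weight f (fst m) (snd m) *
      of_real (multiples_ratio (fst m) (fst z) * multiples_ratio (snd m) (snd z))" for z :: "real \<times> real" and m
  let ?avg = "\<lambda>(x::real, y::real).
      (\<Sum>n1 | 1 \<le> n1 \<and> real n1 \<le> x. \<Sum>n2 | 1 \<le> n2 \<and> real n2 \<le> y. f n1 n2) / of_real (x * y)"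
  \<comment> \<open>\<open>Lim\<close> is pinned down by convergence only along a proper
    filter.\<close>
  have nontriv: "?F \<noteq> bot"
    by (simp add: prod_filter_eq_bot)
  have "((\<lambda>z. infsum (T z) ?N) \<longlongrightarrow> (\<Sum>\<^sub>\<infinity>m\<in>?N. rf_weight f (fst m) (snd m))) ?F"
  proof (rule tendsto_infsum_dominated)
    show "(\<lambda>m. norm (rf_weight f (fst m) (snd m))) summable_on ?N"
      using sum by (simp add: case_prod_unfold)
    fix m assume m: "m \<in> ?N"
    show "norm (T z m) \<le> norm (rf_weight f (fst m) (snd m))" for z
    proof -
      have "multiples_ratio (fst m) (fst z) * multiples_ratio (snd m) (snd z) \<le> 1"
        by (intro mult_le_one multiples_ratio_bounds)
      then show ?thesis
        unfolding T_def norm_mult norm_of_real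
        by (intro mult_left_le) (simp_all add: multiples_ratio_bounds abs_mult)
    qed
    have "((\<lambda>z. multiples_ratio (fst m) (fst z)) \<longlongrightarrow> 1) ?F" "((\<lambda>z. multiples_ratio (snd m) (snd z)) \<longlongrightarrow> 1) ?F"
      using m by (auto intro!: filterlim_compose[OF multiples_ratio_tendsto] filterlim_fst filterlim_snd)
    then have "((\<lambda>z. multiples_ratio (fst m) (fst z) * multiples_ratio (snd m) (snd z)) \<longlongrightarrow> 1 * 1) ?F"
      by (rule tendsto_mult)
    from tendsto_mult[OF tendsto_const tendsto_of_real[OF this]]
    show "((\<lambda>z. T z m) \<longlongrightarrow> rf_weight f (fst m) (snd m)) ?F"
      by (simp add: T_def)
  qed
  moreover have "\<forall>\<^sub>F z in ?F. fst z > 0 \<and> snd z > 0"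
    by (intro eventually_conj eventually_compose_filterlim[OF eventually_gt_at_top filterlim_fst]
          eventually_compose_filterlim[OF eventually_gt_at_top filterlim_snd])
  then have "\<forall>\<^sub>F z in ?F. infsum (T z) ?N = ?avg z"
  proof eventually_elim
    case (elim z)
    obtain x y where z: "z = (x, y)" "x > 0" "y > 0" using elim by (cases z) auto
    let ?X = "nat \<lfloor>x\<rfloor>" and ?Y = "nat \<lfloor>y\<rfloor>"
    have sets: "{n. 1 \<le> n \<and> real n \<le> x} = {1..?X}" "{n. 1 \<le> n \<and> real n \<le> y} = {1..?Y}"
      using z by (auto simp: le_nat_floor le_nat_iff le_floor_iff)
    have T_eq: "T z m = dirichlet_conv2 f moebius2 (fst m) (snd m) *
        of_nat (?X div fst m) * of_nat (?Y div snd m) / of_real (x * y)" if "m \<in> ?N" for m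
      using that z by (auto simp: T_def multiples_ratio_def rf_weight_def field_simps)
    \<comment> \<open>Outside the box one of the integer quotients is 0, so the infinite sum is
      finite.\<close>
    have "(T z has_sum (\<Sum>m\<in>{1..?X} \<times> {1..?Y}. T z m)) ?N"
    proof (rule has_sum_finite_neutralI)
      fix m assume m: "m \<in> ?N - {1..?X} \<times> {1..?Y}"
      then have "?X div fst m = 0 \<or> ?Y div snd m = 0" by (auto simp: not_le div_eq_0_iff)
      then show "T z m = 0" using T_eq[of m] m by auto
    qed auto
    then have "infsum (T z) ?N = (\<Sum>m\<in>{1..?X} \<times> {1..?Y}. T z m)" by (rule infsumI)
    also have "\<dots> = (\<Sum>m\<in>{1..?X} \<times> {1..?Y}. dirichlet_conv2 f moebius2 (fst m) (snd m) *
        of_nat (?X div fst m) * of_nat (?Y div snd m) / of_real (x * y))"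
      by (intro sum.cong refl T_eq) auto
    also have "\<dots> = ?avg z"
      unfolding z(1) prod.case sets
      by (subst sum_eq_sum_dirichlet_conv2)
        (simp only: sum.cartesian_product case_prod_unfold sum_divide_distrib)
    finally show ?case .
  qed
  ultimately have "(?avg \<longlongrightarrow> (\<Sum>\<^sub>\<infinity>m\<in>?N. rf_weight f (fst m) (snd m))) ?F"
    by (rule Lim_transform_eventually)
  then show ?thesis
    unfolding mean_value_def using tendsto_Lim[OF nontriv] by (simp add: case_prod_unfold)
qed

text \<open>
  A vanishing local factor makes convergence of the partial products to \<open>a\<close> weaker than \<open>has_prod\<close>, which
  also demands a nonzero limit of some tail. Absolute convergence of the product provides that tail.
\<close>

lemma local_sum_has_prod:
  assumes f: "multiplicative2 f" "f 1 1 = 1"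
    and sum: "(\<lambda>(p, e1, e2). norm (rf_weight f (p ^ e1) (p ^ e2)))
      summable_on (SIGMA p:{p. prime p}. {(e1, e2). e1 + e2 \<ge> 1})"
    and q: "q1 > 0" "q2 > 0"
  defines "a \<equiv> \<Sum>\<^sub>\<infinity>(m1, m2)\<in>{m. m > 0 \<and> q1 dvd m} \<times> {m. m > 0 \<and> q2 dvd m}. rf_weight f m1 m2"
  shows "(\<lambda>N. \<Prod>p | prime p \<and> p \<le> N. local_sum f p (multiplicity p q1) (multiplicity p q2)) \<longlonglongrightarrow> a"
    and "(\<lambda>p. if prime p then local_sum f p (multiplicity p q1) (multiplicity p q2) else 1) has_prod a"
proof -
  let ?l = "\<lambda>p. local_sum f p (multiplicity p q1) (multiplicity p q2)"
  let ?h = "\<lambda>p. if prime p then ?l p else 1"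
  let ?E = "{(e1, e2). e1 + e2 \<ge> (1::nat)}"
  have G: "multiplicative2 (rf_weight f)" "rf_weight f 1 1 = 1"
    using f multiplicative2_rf_weight rf_weight_11 by auto
  show lim: "(\<lambda>N. \<Prod>p | prime p \<and> p \<le> N. ?l p) \<longlonglongrightarrow> a"
    unfolding local_sum_eq a_def using G sum q by (rule tendsto_euler_product)
  define s where "s = (\<lambda>p. \<Sum>\<^sub>\<infinity>(e1, e2)\<in>?E. norm (rf_weight f (p ^ e1) (p ^ e2)))"
  have s: "s summable_on {p. prime p}"
    "\<And>p. prime p \<Longrightarrow> ((\<lambda>(e1, e2). norm (rf_weight f (p ^ e1) (p ^ e2))) has_sum s p) ?E"
    using has_sum_norm_prime_powers(1,2)[of "rf_weight f", OF sum] by (simp_all add: s_def)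
  have "summable (\<lambda>p. norm (?h p - 1))"
  proof (rule summable_comparison_test_ev)
    have "(\<lambda>p. if prime p then s p else 0) summable_on UNIV"
      using s(1) summable_on_cong_neutral[of UNIV "{p. prime p}" "\<lambda>p. if prime p then s p else 0" s] by auto
    then show "summable (\<lambda>p. if prime p then s p else 0)"
      by (rule summable_on_imp_summable)
    show "\<forall>\<^sub>F p in sequentially. norm (norm (?h p - 1)) \<le> (if prime p then s p else 0)"
      using eventually_gt_at_top[of "max q1 q2"]
    proof eventually_elim
      case (elim p)
      show ?case
      proof (cases "prime p")
        case True
        \<comment> \<open>Primes beyond \<open>q1\<close> and \<open>q2\<close> divide neither, so
          the local sum starts at \<open>(0, 0)\<close>, where the term is 1; the rest is at most
          \<open>s p\<close>.\<close>
        have "\<not> p dvd q1" "\<not> p dvd q2" using elim q by (auto dest: dvd_imp_le)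
        then have "?l p = (\<Sum>\<^sub>\<infinity>(e1, e2)\<in>UNIV. rf_weight f (p ^ e1) (p ^ e2))"
          by (simp add: local_sum_eq not_dvd_imp_multiplicity_0)
        also have "(UNIV :: (nat \<times> nat) set) = insert (0, 0) ?E" by auto
        also have "(\<Sum>\<^sub>\<infinity>(e1, e2)\<in>insert (0, 0) ?E. rf_weight f (p ^ e1) (p ^ e2)) =
            1 + (\<Sum>\<^sub>\<infinity>(e1, e2)\<in>?E. rf_weight f (p ^ e1) (p ^ e2))"
        proof (subst infsum_insert)
          show "(\<lambda>(e1, e2). rf_weight f (p ^ e1) (p ^ e2)) summable_on ?E"
            by (rule abs_summable_summable)
               (use has_sum_imp_summable[OF s(2)[OF True]] in \<open>simp add: case_prod_unfold\<close>)
        qed (use G(2) in auto)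
        finally have "?l p - 1 = (\<Sum>\<^sub>\<infinity>(e1, e2)\<in>?E. rf_weight f (p ^ e1) (p ^ e2))" by simp
        also have "norm \<dots> \<le> s p"
          unfolding s_def using norm_infsum_bound[of "\<lambda>(e1, e2). rf_weight f (p ^ e1) (p ^ e2)" ?E]
            has_sum_imp_summable[OF s(2)[OF True]] by (simp add: case_prod_unfold)
        finally show ?thesis using True by simp
      qed simp
    qed
  qed
  then have conv: "convergent_prod ?h"
    by (intro abs_convergent_prod_imp_convergent_prod summable_imp_abs_convergent_prod)
  have "(\<Prod>p\<le>N. ?h p) = (\<Prod>p | prime p \<and> p \<le> N. ?l p)" for N
    by (subst prod.inter_filter[symmetric]) (auto intro: prod.cong)
  then have "prodinf ?h = a"
    using LIMSEQ_unique[OF convergent_prod_LIMSEQ[OF conv]] lim by simp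
  then show "?h has_prod a" using convergent_prod_has_prod[OF conv] by simp
qed

theorem theorem2p4:
  fixes f :: "nat \<Rightarrow> nat \<Rightarrow> complex"
  assumes "multiplicative2 f"
    and "(\<lambda>(p, e1, e2). norm (dirichlet_conv2 f moebius2 (p ^ e1) (p ^ e2)) / real (p ^ (e1 + e2)))
           summable_on (SIGMA p:{p. prime p}. {(e1, e2). e1 + e2 \<ge> 1})"
  shows "(\<forall>q1\<ge>1. \<forall>q2\<ge>1. rf_term f q1 q2 summable_on ({1..} \<times> {1..})) \<and>
    (\<forall>n1\<ge>1. \<forall>n2\<ge>1.
       ((\<lambda>(q1, q2). rf_coeff f q1 q2 * ramanujan_sum q1 n1 * ramanujan_sum q2 n2)
          has_sum f n1 n2) ({1..} \<times> {1..})) \<and>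
    (mean_value f \<noteq> 0 \<longrightarrow>
      (\<forall>q1\<ge>1. \<forall>q2\<ge>1. lcm q1 q2 > 1 \<longrightarrow>
         (\<lambda>p. if prime p then local_sum f p (multiplicity p q1) (multiplicity p q2) else 1)
            has_prod rf_coeff f q1 q2 \<and>
         rf_coeff f q1 q2 =
            mean_value f *
              (\<Prod>p\<in>{p. prime p \<and> p dvd lcm q1 q2}.
                 local_sum f p (multiplicity p q1) (multiplicity p q2) / local_sum f p 0 0)))"
proof -
  let ?w = squarefree_divisor_count
  let ?M = "\<lambda>q1 q2. {m::nat. m > 0 \<and> q1 dvd m} \<times> {m::nat. m > 0 \<and> q2 dvd m}"
  have sum: "(\<lambda>(p, e1, e2). norm (rf_weight f (p ^ e1) (p ^ e2)))
      summable_on (SIGMA p:{p. prime p}. {(e1, e2). e1 + e2 \<ge> 1})"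
    using assms(2) by (simp add: rf_weight_prime_power norm_divide norm_power)
  have wsum: "(\<lambda>(m1, m2). ?w m1 * ?w m2 * norm (rf_weight f m1 m2)) summable_on {1..} \<times> {1..}"
    using assms(1) sum by (rule rf_weight_weighted_summable)
  \<comment> \<open>The weights are at least 1, so they may be dropped.\<close>
  have "(\<lambda>m. norm (rf_weight f (fst m) (snd m))) summable_on {1..} \<times> {1..}"
  proof (rule Infinite_Sum.abs_summable_on_comparison_test'[OF wsum])
    fix m :: "nat \<times> nat" assume "m \<in> {1..} \<times> {1..}"
    then have "1 * 1 \<le> ?w (fst m) * ?w (snd m)"
      by (intro mult_mono squarefree_divisor_count_ge_1 squarefree_divisor_count_nonneg) auto
    then show "norm (rf_weight f (fst m) (snd m)) \<le>
        (case m of (m1, m2) \<Rightarrow> ?w m1 * ?w m2 * norm (rf_weight f m1 m2))"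
      using mult_right_mono[of 1 _ "norm (rf_weight f (fst m) (snd m))"] by (simp add: case_prod_unfold)
  qed
  then have nsum: "(\<lambda>(m1, m2). norm (rf_weight f m1 m2)) summable_on {1..} \<times> {1..}"
    by (simp add: case_prod_unfold)
  have coeff: "((\<lambda>(m1, m2). rf_weight f m1 m2) has_sum rf_coeff f q1 q2) (?M q1 q2)"
    and term_sum: "rf_term f q1 q2 summable_on {1..} \<times> {1..}" if "q1 > 0" "q2 > 0" for q1 q2
  proof -
    have "(\<lambda>(m1, m2). norm (rf_weight f m1 m2)) summable_on ?M q1 q2"
      using nsum by (rule summable_on_subset_banach) auto
    then have "(\<lambda>(m1, m2). rf_weight f m1 m2) summable_on ?M q1 q2"
      by (intro abs_summable_summable[of "\<lambda>(m1, m2). rf_weight f m1 m2"]) (simp add: case_prod_unfold)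
    then obtain S where S: "((\<lambda>(m1, m2). rf_weight f m1 m2) has_sum S) (?M q1 q2)"
      by (auto simp: summable_on_def)
    then have "(rf_term f q1 q2 has_sum S) ({1..} \<times> {1..})"
      using has_sum_rf_term_iff[OF that] by blast
    then show "rf_term f q1 q2 summable_on {1..} \<times> {1..}"
      and "((\<lambda>(m1, m2). rf_weight f m1 m2) has_sum rf_coeff f q1 q2) (?M q1 q2)"
      using S infsumI by (auto simp: summable_on_def rf_coeff_def)
  qed
  have pos: "{m::nat. m > 0 \<and> 1 dvd m} = {1..}" by auto
  \<comment> \<open>The mean value is the coefficient sum for \<open>q1 = q2 = 1\<close>, so the
    Euler product covers it as well.\<close>
  have mean: "mean_value f = (\<Sum>\<^sub>\<infinity>(m1, m2)\<in>?M 1 1. rf_weight f m1 m2)"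
    using mean_value_eq_infsum[OF nsum] unfolding pos .
  have product: "(\<lambda>p. if prime p then local_sum f p (multiplicity p q1) (multiplicity p q2) else 1)
      has_prod rf_coeff f q1 q2 \<and> rf_coeff f q1 q2 = mean_value f *
      (\<Prod>p\<in>{p. prime p \<and> p dvd lcm q1 q2}.
         local_sum f p (multiplicity p q1) (multiplicity p q2) / local_sum f p 0 0)"
    if nz: "mean_value f \<noteq> 0" and q: "q1 > 0" "q2 > 0" for q1 q2
  proof -
    let ?l = "\<lambda>p. local_sum f p (multiplicity p q1) (multiplicity p q2)"
    let ?z = "\<lambda>p. local_sum f p 0 0"
    let ?Q = "{p. prime p \<and> p dvd lcm q1 q2}"
    \<comment> \<open>Otherwise \<open>rf_weight f\<close> vanishes on positive arguments and the
      mean value is 0.\<close>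
    have f11: "f 1 1 = 1"
    proof (rule multiplicative2_11[OF multiplicative2_rf_weight[OF assms(1)]])
      assume "\<And>m n. m > 0 \<Longrightarrow> n > 0 \<Longrightarrow> rf_weight f m n = 0"
      then have "(\<Sum>\<^sub>\<infinity>(m1, m2)\<in>?M 1 1. rf_weight f m1 m2) = 0"
        by (intro infsum_0) auto
      with nz mean show ?thesis by simp
    qed (simp only: rf_weight_11)
    have "(\<Sum>\<^sub>\<infinity>(m1, m2)\<in>?M q1 q2. rf_weight f m1 m2) = rf_coeff f q1 q2"
      using coeff[OF q] by (rule infsumI)
    note l = local_sum_has_prod[OF assms(1) f11 sum q, unfolded this]
    have lim: "(\<lambda>N. \<Prod>p | prime p \<and> p \<le> N. ?l p) \<longlonglongrightarrow> rf_coeff f q1 q2"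
      and prod: "(\<lambda>p. if prime p then ?l p else 1) has_prod rf_coeff f q1 q2"
      by (fact l)+
    have lim0: "(\<lambda>N. \<Prod>p | prime p \<and> p \<le> N. ?z p) \<longlonglongrightarrow> mean_value f"
      using local_sum_has_prod(1)[OF assms(1) f11 sum, of 1 1] by (simp only: mean) simp
    \<comment> \<open>A vanishing factor would make all later partial products zero, and with them
      the mean value.\<close>
    have l0_nz: "?z p \<noteq> 0" if "prime p" for p
    proof
      assume "?z p = 0"
      have "\<forall>\<^sub>F N in sequentially. (\<Prod>p | prime p \<and> p \<le> N. ?z p) = 0"
        using eventually_ge_at_top[of p]
        by eventually_elim (use that \<open>?z p = 0\<close> in auto)
      then have "(\<lambda>N. \<Prod>p | prime p \<and> p \<le> N. ?z p) \<longlonglongrightarrow> 0"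
        by (rule tendsto_eventually)
      with lim0 nz LIMSEQ_unique show False by blast
    qed
    \<comment> \<open>Once \<open>N\<close> reaches \<open>lcm q1 q2\<close>, the two partial
      products differ only at the primes dividing it; at the others both multiplicities are 0 and
      the factors coincide.\<close>
    have "\<forall>\<^sub>F N in sequentially.
        (\<Prod>p | prime p \<and> p \<le> N. ?z p) * (\<Prod>p\<in>?Q. ?l p / ?z p) = (\<Prod>p | prime p \<and> p \<le> N. ?l p)"
      using eventually_ge_at_top[of "lcm q1 q2"]
    proof eventually_elim
      case (elim N)
      have fin: "finite {p. prime p \<and> p \<le> N}" by simp
      have lcm: "lcm q1 q2 > 0" using q by (simp add: lcm_pos_nat)
      have "?Q = {p \<in> {p. prime p \<and> p \<le> N}. p dvd lcm q1 q2}"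
        using elim lcm by (auto dest: dvd_imp_le)
      then have "(\<Prod>p\<in>?Q. ?l p / ?z p) =
          (\<Prod>p | prime p \<and> p \<le> N. if p dvd lcm q1 q2 then ?l p / ?z p else 1)"
        by (simp only: prod.inter_filter[OF fin])
      then have "(\<Prod>p | prime p \<and> p \<le> N. ?z p) * (\<Prod>p\<in>?Q. ?l p / ?z p) =
          (\<Prod>p | prime p \<and> p \<le> N. ?z p * (if p dvd lcm q1 q2 then ?l p / ?z p else 1))"
        by (simp add: prod.distrib)
      also have "\<dots> = (\<Prod>p | prime p \<and> p \<le> N. ?l p)"
      proof (intro prod.cong refl)
        fix p assume p: "p \<in> {p. prime p \<and> p \<le> N}"
        show "?z p * (if p dvd lcm q1 q2 then ?l p / ?z p else 1) = ?l p"
        proof (cases "p dvd lcm q1 q2")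
          case False
          then have "\<not> p dvd q1" "\<not> p dvd q2" by (meson dvd_lcm1 dvd_lcm2 dvd_trans)+
          with False show ?thesis by (simp add: not_dvd_imp_multiplicity_0)
        qed (use p l0_nz in simp)
      qed
      finally show ?case .
    qed
    then have "(\<lambda>N. \<Prod>p | prime p \<and> p \<le> N. ?l p) \<longlonglongrightarrow> mean_value f * (\<Prod>p\<in>?Q. ?l p / ?z p)"
      using tendsto_mult[OF lim0 tendsto_const] by (rule Lim_transform_eventually[rotated])
    with lim LIMSEQ_unique prod show ?thesis by blast
  qed
  show ?thesis
  proof (intro conjI allI impI)
    fix n1 n2 :: nat assume "n1 \<ge> 1" "n2 \<ge> 1"
    then show "((\<lambda>(q1, q2). rf_coeff f q1 q2 * ramanujan_sum q1 n1 * ramanujan_sum q2 n2)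
          has_sum f n1 n2) ({1..} \<times> {1..})"
      using wsum coeff by (intro ramanujan_fourier_expansion) auto
  next
    fix q1 q2 :: nat assume "q1 \<ge> 1" "q2 \<ge> 1"
    then have q: "q1 > 0" "q2 > 0" by simp_all
    show "rf_term f q1 q2 summable_on {1..} \<times> {1..}"
      using q by (rule term_sum)
    assume "mean_value f \<noteq> 0"
    note p = product[OF this q]
    show "(\<lambda>p. if prime p then local_sum f p (multiplicity p q1) (multiplicity p q2) else 1)
        has_prod rf_coeff f q1 q2"
      using p by (rule conjunct1)
    show "rf_coeff f q1 q2 = mean_value f *
        (\<Prod>p\<in>{p. prime p \<and> p dvd lcm q1 q2}.
           local_sum f p (multiplicity p q1) (multiplicity p q2) / local_sum f p 0 0)"
      using p by (rule conjunct2)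
  qed
qed

end
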